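(* Let $k$ be a field, $G$ an absolutely simple linear algebraic group over $k$ with Coxeter number $h$, assume $\operatorname{char} k$ is $0$ or at least $h+2$, let $\mathfrak g=\operatorname{Lie}(G)$, let $A(\mathfrak g)$ be the commutative $k$-algebra with product $\diamond$ defined in the context, and let $\tau$ be the bilinear form on $A(\mathfrak g)$ given by $\tau(a,a')=\frac1{\dim G}\operatorname{Tr}(a\diamond a')$. Then \[ \tau(a\diamond a',a'')=\tau(a,a'\diamond a'')\quad\text{for all } a,a',a''\in A(\mathfrak g). \]
   Context: Absolutely simple linear algebraic group: a smooth affine group scheme $G$ of finite type over $k$ such that $G\times\bar k$ is connected, semisimple, $\neq 1$, with irreducible root system. $h$, $h^\vee$ are the Coxeter and dual Coxeter numbers of the root system of $G$. Under the assumption on $\operatorname{char} k$, the Killing form $K$ of $\mathfrak g$ is nondegenerate and $\dim G\neq0$ in $k$. For $T,U\in\operatorname{End}(\mathfrak g)$ put $T\bullet U:=\frac12(TU+UT)$. $\mathrm S^2\mathfrak g$ is the symmetric square of $\mathfrak g$. Define linear maps $P,S\colon\mathrm S^2\mathfrak g\to\operatorname{End}(\mathfrak g)$ by $P(XY)(Z)=\frac12\left[K(Y,Z)X+K(X,Z)Y\right]$ and $S(XY)=h^\vee\,\operatorname{ad}(X)\bullet\operatorname{ad}(Y)+P(XY)$ for $X,Y,Z\in\mathfrak g$. Put $A(\mathfrak g):=\operatorname{im} S$. The product $\diamond$ on $A(\mathfrak g)$ is the (well-defined) symmetric bilinear map determined by, for $A,B,C,D\in\mathfrak g$ (writing $S(X,Y)$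 for $S(XY)$): \begin{align*} S(AB)\diamond S(CD) = {}& \tfrac{h^\vee}{2}\big( S(A,(\operatorname{ad} C\bullet\operatorname{ad} D)B)+S((\operatorname{ad} C\bullet\operatorname{ad} D)A, B)\big)\\ &+\tfrac{h^\vee}{2}\big( S(C,(\operatorname{ad} A\bullet\operatorname{ad} B)D)+S((\operatorname{ad} A\bullet\operatorname{ad} B)C, D)\big)\\ &+\tfrac{h^\vee}{2}\big( S([A,C],[B,D])+S([A,D],[B,C])\big)\\ &+\tfrac14\big(K(A,C)S(B,D)+K(A,D)S(B,C)+K(B,C)S(A,D)+K(B,D)S(A,C)\big). \end{align*} $\operatorname{Tr}$ is the trace of endomorphisms of $\mathfrak g$. *)

theory Defs
  imports
    "HOL-Analysis.Analysis"
    "HOL-Library.Poly_Mapping"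
    "HOL-Library.Function_Algebras"
    "HOL-Algebra.Algebraic_Closure_Type"
    "HOL-Algebra.Solvable_Groups"
begin

section \<open>Tensor powers\<close>

text \<open>
  Let \<open>A\<close> (type \<open>'a\<close>) be a \<open>k\<close>-algebra with structure map \<open>u\<close> and \<open>B\<close> (type \<open>'b\<close>) one with
  structure map \<open>v\<close>.  An element of \<open>B \<otimes> A \<otimes> \<dots> \<otimes> A\<close> (tensor products over \<open>k\<close>, \<open>n\<close> factors
  \<open>A\<close>) is represented by an element of the free \<open>B\<close>-module on the words of length \<open>n\<close> over \<open>A\<close>;
  two such formal sums represent the same tensor iff they differ by an element of the
  submodule generated by the multilinearity relations.  For \<open>B = k\<close> this is the \<open>n\<close>-fold tensor
  power of \<open>A\<close>; for \<open>n = 1\<close> it is the base change of \<open>A\<close> to \<open>B\<close>.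
\<close>

definition formal_scale :: "'b::comm_ring_1 \<Rightarrow> ('w \<Rightarrow>\<^sub>0 'b) \<Rightarrow> ('w \<Rightarrow>\<^sub>0 'b)" where
  "formal_scale c t = Poly_Mapping.map ((*) c) t"

definition formal_extend :: "('w \<Rightarrow> ('x \<Rightarrow>\<^sub>0 'b::comm_ring_1)) \<Rightarrow> ('w \<Rightarrow>\<^sub>0 'b) \<Rightarrow> ('x \<Rightarrow>\<^sub>0 'b)" where
  "formal_extend f t = (\<Sum>w\<in>Poly_Mapping.keys t. formal_scale (Poly_Mapping.lookup t w) (f w))"

definition tensor_relators ::
    "('k \<Rightarrow> 'a::comm_ring_1) \<Rightarrow> ('k \<Rightarrow> 'b::comm_ring_1) \<Rightarrow> ('a list \<Rightarrow>\<^sub>0 'b) set" where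
  "tensor_relators u v =
     {Poly_Mapping.single (xs @ [a + b] @ ys) 1
        - Poly_Mapping.single (xs @ [a] @ ys) 1 - Poly_Mapping.single (xs @ [b] @ ys) 1
        | xs a b ys. True} \<union>
     {Poly_Mapping.single (xs @ [u c * a] @ ys) 1 - Poly_Mapping.single (xs @ [a] @ ys) (v c)
        | xs c a ys. True}"

definition tensor_null ::
    "('k \<Rightarrow> 'a::comm_ring_1) \<Rightarrow> ('k \<Rightarrow> 'b::comm_ring_1) \<Rightarrow> ('a list \<Rightarrow>\<^sub>0 'b) set" where
  "tensor_null u v = Modules.module.span formal_scale (tensor_relators u v)"

definition tensor_mult ::
    "('a::comm_ring_1 list \<Rightarrow>\<^sub>0 'b::comm_ring_1) \<Rightarrow> ('a list \<Rightarrow>\<^sub>0 'b) \<Rightarrow> ('a list \<Rightarrow>\<^sub>0 'b)" where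
  "tensor_mult s t =
     formal_extend (\<lambda>w. formal_extend (\<lambda>w'. Poly_Mapping.single (map2 (*) w w') 1) t) s"


section \<open>Affine group schemes as commutative Hopf algebras\<close>

text \<open>
  The coordinate ring of an affine group scheme over the field \<open>'k\<close> is the whole type \<open>'a\<close>.
  The comultiplication \<open>co_mult a\<close> is a formal sum of words of length 2 representing an element
  of \<open>A \<otimes> A\<close>.
\<close>

record (overloaded) ('k, 'a) group_scheme =
  str_map :: "'k \<Rightarrow> 'a"
  co_mult :: "'a \<Rightarrow> ('a list \<Rightarrow>\<^sub>0 'k)"
  co_unit :: "'a \<Rightarrow> 'k"
  antipode :: "'a \<Rightarrow> 'a"

definition alg_hom ::
    "('k \<Rightarrow> 'a::comm_ring_1) \<Rightarrow> ('k \<Rightarrow> 'b::comm_ring_1) \<Rightarrow> ('a \<Rightarrow> 'b) \<Rightarrow> bool" where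
  "alg_hom u v f \<longleftrightarrow>
     f 1 = 1 \<and> (\<forall>x y. f (x + y) = f x + f y) \<and> (\<forall>x y. f (x * y) = f x * f y) \<and>
     (\<forall>c. f (u c) = v c)"

definition tensor_eq ::
    "('k::field, 'a::comm_ring_1) group_scheme \<Rightarrow> ('a list \<Rightarrow>\<^sub>0 'k) \<Rightarrow> ('a list \<Rightarrow>\<^sub>0 'k) \<Rightarrow> bool" where
  "tensor_eq G s t \<longleftrightarrow> s - t \<in> tensor_null (str_map G) id"

text \<open>\<open>co_mult_left\<close> is \<open>(\<Delta> \<otimes> id) \<circ> \<Delta>\<close> and \<open>co_mult_right\<close> is \<open>(id \<otimes> \<Delta>) \<circ> \<Delta>\<close>.\<close>

definition co_mult_left ::
    "('k::field, 'a::comm_ring_1) group_scheme \<Rightarrow> 'a \<Rightarrow> ('a list \<Rightarrow>\<^sub>0 'k)" where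
  "co_mult_left G a =
     formal_extend (\<lambda>w. formal_extend (\<lambda>w'. Poly_Mapping.single (w' @ [w ! 1]) 1)
       (co_mult G (w ! 0))) (co_mult G a)"

definition co_mult_right ::
    "('k::field, 'a::comm_ring_1) group_scheme \<Rightarrow> 'a \<Rightarrow> ('a list \<Rightarrow>\<^sub>0 'k)" where
  "co_mult_right G a =
     formal_extend (\<lambda>w. formal_extend (\<lambda>w'. Poly_Mapping.single ([w ! 0] @ w') 1)
       (co_mult G (w ! 1))) (co_mult G a)"

definition sweedler_sum ::
    "('k::field, 'a::comm_ring_1) group_scheme \<Rightarrow> ('a \<Rightarrow> 'a \<Rightarrow> 'a) \<Rightarrow> 'a \<Rightarrow> 'a" where
  "sweedler_sum G f a =
     (\<Sum>w\<in>Poly_Mapping.keys (co_mult G a).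
        str_map G (Poly_Mapping.lookup (co_mult G a) w) * f (w ! 0) (w ! 1))"

definition affine_group_scheme ::
    "('k::field, 'a::comm_ring_1) group_scheme \<Rightarrow> bool" where
  "affine_group_scheme G \<longleftrightarrow>
     alg_hom id (str_map G) (str_map G) \<and>
     alg_hom (str_map G) id (co_unit G) \<and>
     alg_hom (str_map G) (str_map G) (antipode G) \<and>
     \<comment> \<open>the comultiplication is a homomorphism of algebras\<close>
     (\<forall>a. \<forall>w\<in>Poly_Mapping.keys (co_mult G a). length w = 2) \<and>
     tensor_eq G (co_mult G 1) (Poly_Mapping.single [1, 1] 1) \<and>
     (\<forall>a b. tensor_eq G (co_mult G (a + b)) (co_mult G a + co_mult G b)) \<and>
     (\<forall>a b. tensor_eq G (co_mult G (a * b)) (tensor_mult (co_mult G a) (co_mult G b))) \<and>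
     (\<forall>c a. tensor_eq G (co_mult G (str_map G c * a)) (formal_scale c (co_mult G a))) \<and>
     \<comment> \<open>coassociativity, counit and antipode\<close>
     (\<forall>a. tensor_eq G (co_mult_left G a) (co_mult_right G a)) \<and>
     (\<forall>a. sweedler_sum G (\<lambda>x y. str_map G (co_unit G x) * y) a = a) \<and>
     (\<forall>a. sweedler_sum G (\<lambda>x y. x * str_map G (co_unit G y)) a = a) \<and>
     (\<forall>a. sweedler_sum G (\<lambda>x y. antipode G x * y) a = str_map G (co_unit G a)) \<and>
     (\<forall>a. sweedler_sum G (\<lambda>x y. x * antipode G y) a = str_map G (co_unit G a))"

definition of_finite_type :: "('k::field, 'a::comm_ring_1) group_scheme \<Rightarrow> bool" where
  "of_finite_type G \<longleftrightarrow>
     (\<exists>F. finite F \<and>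
        (\<forall>C. F \<subseteq> C \<and> range (str_map G) \<subseteq> C \<and> (\<forall>x\<in>C. \<forall>y\<in>C. x + y \<in> C \<and> x * y \<in> C)
           \<longrightarrow> C = UNIV))"

text \<open>
  A group scheme of finite type over a field is smooth iff it is geometrically reduced, i.e.
  the base change of its coordinate ring to the algebraic closure has no nonzero nilpotents.
\<close>

definition smooth_scheme :: "('k::field, 'a::comm_ring_1) group_scheme \<Rightarrow> bool" where
  "smooth_scheme G \<longleftrightarrow>
     (\<forall>(t :: 'a list \<Rightarrow>\<^sub>0 'k alg_closure) n.
        (\<forall>w\<in>Poly_Mapping.keys t. length w = 1) \<and>
        (tensor_mult t ^^ n) (Poly_Mapping.single [1] 1) \<in> tensor_null (str_map G) to_ac
        \<longrightarrow> t \<in> tensor_null (str_map G) to_ac)"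

text \<open>The Krull dimension of the coordinate ring.\<close>

definition scheme_dim :: "('k::field, 'a::comm_ring_1) group_scheme \<Rightarrow> nat" where
  "scheme_dim G =
     (GREATEST n. \<exists>Q. (\<forall>i\<le>n. primeideal (Q i) (ring_of_type_algebra :: 'a ring)) \<and>
                      (\<forall>i<n. Q i \<subset> Q (Suc i)))"


section \<open>The Lie algebra\<close>

text \<open>Left invariant derivations of the coordinate ring, with the commutator bracket.\<close>

definition lie_scale :: "('k::field, 'a::comm_ring_1) group_scheme \<Rightarrow> 'k \<Rightarrow> ('a \<Rightarrow> 'a) \<Rightarrow> ('a \<Rightarrow> 'a)"
  where "lie_scale G c D = (\<lambda>a. str_map G c * D a)"

definition Lie :: "('k::field, 'a::comm_ring_1) group_scheme \<Rightarrow> ('a \<Rightarrow> 'a) set" where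
  "Lie G = {D.
     (\<forall>a b. D (a + b) = D a + D b) \<and>
     (\<forall>c a. D (str_map G c * a) = str_map G c * D a) \<and>
     (\<forall>a b. D (a * b) = a * D b + D a * b) \<and>
     (\<forall>a. tensor_eq G (co_mult G (D a))
            (formal_extend (\<lambda>w. Poly_Mapping.single [w ! 0, D (w ! 1)] 1) (co_mult G a)))}"

definition lie_bracket :: "('a::comm_ring_1 \<Rightarrow> 'a) \<Rightarrow> ('a \<Rightarrow> 'a) \<Rightarrow> ('a \<Rightarrow> 'a)" where
  "lie_bracket D E = (\<lambda>a. D (E a) - E (D a))"


section \<open>The base change to the algebraic closure\<close>

text \<open>
  For smooth \<open>G\<close> the base change to the algebraic closure \<open>K\<close> is treated as the classical
  linear algebraic group \<open>G(K)\<close>, whose points are the \<open>k\<close>-algebra homomorphisms from the coordinate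
  ring to \<open>K\<close> and whose regular functions are the \<open>K\<close>-linear combinations of evaluations
  at elements of the coordinate ring.
\<close>

type_synonym ('k, 'a) geom_point = "'a \<Rightarrow> 'k alg_closure"

definition geom_group ::
    "('k::field, 'a::comm_ring_1) group_scheme \<Rightarrow> ('k, 'a) geom_point monoid" where
  "geom_group G =
     \<lparr>carrier = {x. alg_hom (str_map G) to_ac x},
      monoid.mult = (\<lambda>x y a. \<Sum>w\<in>Poly_Mapping.keys (co_mult G a).
        to_ac (Poly_Mapping.lookup (co_mult G a) w) * x (w ! 0) * y (w ! 1)),
      one = (\<lambda>a. to_ac (co_unit G a))\<rparr>"

definition regular_on :: "('k::field, 'a) geom_point set \<Rightarrow>
    (('k, 'a) geom_point \<Rightarrow> 'k alg_closure) \<Rightarrow> bool" where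
  "regular_on Y f \<longleftrightarrow>
     (\<exists>t :: 'a \<Rightarrow>\<^sub>0 'k alg_closure. \<forall>x\<in>Y. f x = (\<Sum>a\<in>Poly_Mapping.keys t. Poly_Mapping.lookup t a * x a))"

definition zariski ::
    "('k::field, 'a::comm_ring_1) group_scheme \<Rightarrow> ('k, 'a) geom_point topology" where
  "zariski G = topology_generated_by
     {{x \<in> carrier (geom_group G). f x \<noteq> 0} | f. regular_on (carrier (geom_group G)) f}"

definition geom_connected :: "('k::field, 'a::comm_ring_1) group_scheme \<Rightarrow> bool" where
  "geom_connected G \<longleftrightarrow> connected_space (zariski G)"

definition geom_nontrivial :: "('k::field, 'a::comm_ring_1) group_scheme \<Rightarrow> bool" where
  "geom_nontrivial G \<longleftrightarrow> carrier (geom_group G) \<noteq> {\<one>\<^bsub>geom_group G\<^esub>}"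

text \<open>Trivial radical.\<close>

definition geom_semisimple :: "('k::field, 'a::comm_ring_1) group_scheme \<Rightarrow> bool" where
  "geom_semisimple G \<longleftrightarrow>
     (\<forall>H. H \<lhd> geom_group G \<and> closedin (zariski G) H \<and> connectedin (zariski G) H \<and>
          solvable ((geom_group G)\<lparr>carrier := H\<rparr>) \<longrightarrow> H = {\<one>\<^bsub>geom_group G\<^esub>})"

text \<open>
  A torus is a closed subgroup isomorphic, as an algebraic group, to the group of \<open>n\<close>-tuples of
  nonzero scalars, whose regular functions are the Laurent polynomials.
\<close>

definition laurent_eval :: "nat \<Rightarrow> ((nat \<Rightarrow> int) \<Rightarrow>\<^sub>0 'f::field) \<Rightarrow> (nat \<Rightarrow> 'f) \<Rightarrow> 'f" where
  "laurent_eval n p z =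
     (\<Sum>m\<in>Poly_Mapping.keys p. Poly_Mapping.lookup p m * (\<Prod>i<n. z i powi m i))"

definition is_torus :: "('k::field, 'a::comm_ring_1) group_scheme \<Rightarrow> ('k, 'a) geom_point set \<Rightarrow> bool"
  where
  "is_torus G T \<longleftrightarrow>
     subgroup T (geom_group G) \<and> closedin (zariski G) T \<and>
     (\<exists>n (\<phi> :: ('k, 'a) geom_point \<Rightarrow> nat \<Rightarrow> 'k alg_closure).
        bij_betw \<phi> T ({..<n} \<rightarrow>\<^sub>E UNIV - {0}) \<and>
        (\<forall>x\<in>T. \<forall>y\<in>T. \<forall>i<n. \<phi> (x \<otimes>\<^bsub>geom_group G\<^esub> y) i = \<phi> x i * \<phi> y i) \<and>
        (\<forall>i<n. regular_on T (\<lambda>x. \<phi> x i) \<and> regular_on T (\<lambda>x. inverse (\<phi> x i))) \<and>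
        (\<forall>a. \<exists>p. \<forall>x\<in>T. x a = laurent_eval n p (\<phi> x)))"

definition is_maximal_torus ::
    "('k::field, 'a::comm_ring_1) group_scheme \<Rightarrow> ('k, 'a) geom_point set \<Rightarrow> bool" where
  "is_maximal_torus G T \<longleftrightarrow> is_torus G T \<and> (\<forall>T'. is_torus G T' \<and> T \<subseteq> T' \<longrightarrow> T' = T)"

definition characters :: "('k::field, 'a::comm_ring_1) group_scheme \<Rightarrow> ('k, 'a) geom_point set \<Rightarrow>
    (('k, 'a) geom_point \<Rightarrow> 'k alg_closure) set" where
  "characters G T =
     {\<xi> \<in> T \<rightarrow>\<^sub>E (UNIV - {0}). regular_on T \<xi> \<and>
        (\<forall>x\<in>T. \<forall>y\<in>T. \<xi> (x \<otimes>\<^bsub>geom_group G\<^esub> y) = \<xi> x * \<xi> y)}"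

text \<open>
  The Lie algebra of the base change, as the \<open>K\<close>-valued derivations at the identity,
  with the adjoint action: the differential of conjugation by the point \<open>x\<close>.
\<close>

definition geom_tangent ::
    "('k::field, 'a::comm_ring_1) group_scheme \<Rightarrow> ('a \<Rightarrow> 'k alg_closure) set" where
  "geom_tangent G = {d.
     (\<forall>a b. d (a + b) = d a + d b) \<and>
     (\<forall>c a. d (str_map G c * a) = to_ac c * d a) \<and>
     (\<forall>a b. d (a * b) = to_ac (co_unit G a) * d b + d a * to_ac (co_unit G b))}"

definition Ad :: "('k::field, 'a::comm_ring_1) group_scheme \<Rightarrow> ('k, 'a) geom_point \<Rightarrow>
    ('a \<Rightarrow> 'k alg_closure) \<Rightarrow> ('a \<Rightarrow> 'k alg_closure)" where
  "Ad G x d = (\<lambda>a. \<Sum>w\<in>Poly_Mapping.keys (co_mult_right G a).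
     to_ac (Poly_Mapping.lookup (co_mult_right G a) w) *
       x (w ! 0) * d (w ! 1) * x (antipode G (w ! 2)))"

definition roots :: "('k::field, 'a::comm_ring_1) group_scheme \<Rightarrow> ('k, 'a) geom_point set \<Rightarrow>
    (('k, 'a) geom_point \<Rightarrow> 'k alg_closure) set" where
  "roots G T =
     {\<alpha> \<in> characters G T. (\<exists>x\<in>T. \<alpha> x \<noteq> 1) \<and>
        (\<exists>d\<in>geom_tangent G. d \<noteq> (\<lambda>_. 0) \<and> (\<forall>x\<in>T. Ad G x d = (\<lambda>a. \<alpha> x * d a)))}"


section \<open>Root systems\<close>

definition root_reflection :: "'e::euclidean_space \<Rightarrow> 'e \<Rightarrow> 'e" where
  "root_reflection \<alpha> v = v - (2 * (v \<bullet> \<alpha>) / (\<alpha> \<bullet> \<alpha>)) *\<^sub>R \<alpha>"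

definition is_root_system :: "'e::euclidean_space set \<Rightarrow> bool" where
  "is_root_system \<Phi> \<longleftrightarrow>
     finite \<Phi> \<and> span \<Phi> = UNIV \<and> 0 \<notin> \<Phi> \<and>
     (\<forall>\<alpha>\<in>\<Phi>. \<forall>c. c *\<^sub>R \<alpha> \<in> \<Phi> \<longrightarrow> c = 1 \<or> c = - 1) \<and>
     (\<forall>\<alpha>\<in>\<Phi>. root_reflection \<alpha> ` \<Phi> = \<Phi>) \<and>
     (\<forall>\<alpha>\<in>\<Phi>. \<forall>\<beta>\<in>\<Phi>. 2 * (\<beta> \<bullet> \<alpha>) / (\<alpha> \<bullet> \<alpha>) \<in> \<int>)"

definition irreducible_roots :: "'e::euclidean_space set \<Rightarrow> bool" where
  "irreducible_roots \<Phi> \<longleftrightarrow>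
     \<Phi> \<noteq> {} \<and>
     \<not> (\<exists>A B. A \<noteq> {} \<and> B \<noteq> {} \<and> A \<union> B = \<Phi> \<and> A \<inter> B = {} \<and> (\<forall>a\<in>A. \<forall>b\<in>B. a \<bullet> b = 0))"

definition nonneg_comb :: "'e::euclidean_space set \<Rightarrow> 'e \<Rightarrow> bool" where
  "nonneg_comb B v \<longleftrightarrow> (\<exists>c :: 'e \<Rightarrow> nat. v = (\<Sum>b\<in>B. of_nat (c b) *\<^sub>R b))"

definition is_base :: "'e::euclidean_space set \<Rightarrow> 'e set \<Rightarrow> bool" where
  "is_base \<Phi> B \<longleftrightarrow>
     B \<subseteq> \<Phi> \<and> independent B \<and> span B = UNIV \<and> (\<forall>\<beta>\<in>\<Phi>. nonneg_comb B \<beta> \<or> nonneg_comb B (- \<beta>))"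

text \<open>The numbers defined below do not depend on the chosen base or its ordering.\<close>

definition simple_roots :: "'e::euclidean_space set \<Rightarrow> 'e list" where
  "simple_roots \<Phi> = (SOME bs. distinct bs \<and> is_base \<Phi> (set bs))"

text \<open>The order of a Coxeter element, i.e. of a product of all simple reflections.\<close>

definition coxeter_number :: "'e::euclidean_space set \<Rightarrow> nat" where
  "coxeter_number \<Phi> =
     (let w = foldr (\<lambda>\<alpha> f. root_reflection \<alpha> \<circ> f) (simple_roots \<Phi>) id
      in LEAST n. 0 < n \<and> w ^^ n = id)"

definition highest_root :: "'e::euclidean_space set \<Rightarrow> 'e" where
  "highest_root \<Phi> = (THE \<theta>. \<theta> \<in> \<Phi> \<and> (\<forall>\<beta>\<in>\<Phi>. nonneg_comb (set (simple_roots \<Phi>)) (\<theta> - \<beta>)))"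

text \<open>
  \<open>1 + \<langle>\<rho>, \<theta>\<^sup>\<or>\<rangle>\<close>, where \<open>\<theta>\<^sup>\<or> = 2\<theta> / (\<theta> \<bullet> \<theta>)\<close> is the coroot of the highest root and
  \<open>\<rho>\<close> is half the sum of the positive roots.
\<close>

definition dual_coxeter_number :: "'e::euclidean_space set \<Rightarrow> nat" where
  "dual_coxeter_number \<Phi> =
     (let \<theta> = highest_root \<Phi>;
          \<rho> = (1 / 2) *\<^sub>R (\<Sum>\<beta> | \<beta> \<in> \<Phi> \<and> nonneg_comb (set (simple_roots \<Phi>)) \<beta>. \<beta>)
      in nat \<lfloor>1 + 2 * (\<rho> \<bullet> \<theta>) / (\<theta> \<bullet> \<theta>)\<rfloor>)"

text \<open>
  \<open>\<Phi>\<close> is the root system of \<open>G\<close>: some injective homomorphism from the (multiplicatively written)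
  character group of a maximal torus to the additive group of the Euclidean space maps the
  roots onto \<open>\<Phi>\<close>.  As \<open>\<Phi>\<close> is a root system and the roots of a semisimple group generate a
  subgroup of finite index of the character group, the homomorphism extends to an isomorphism
  from the character group tensored with \<open>\<real>\<close>.
\<close>

definition root_system_of ::
    "('k::field, 'a::comm_ring_1) group_scheme \<Rightarrow> 'e::euclidean_space set \<Rightarrow> bool" where
  "root_system_of G \<Phi> \<longleftrightarrow>
     is_root_system \<Phi> \<and>
     (\<exists>T f. is_maximal_torus G T \<and> inj_on f (characters G T) \<and>
        (\<forall>\<xi>\<in>characters G T. \<forall>\<psi>\<in>characters G T. f (\<lambda>x\<in>T. \<xi> x * \<psi> x) = f \<xi> + f \<psi>) \<and>
        f ` roots G T = \<Phi>)"

text \<open>\<open>G\<close> is an absolutely simple linear algebraic group, and its root system is \<open>\<Phi>\<close>.\<close>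

definition absolutely_simple_group ::
    "('k::field, 'a::comm_ring_1) group_scheme \<Rightarrow> 'e::euclidean_space set \<Rightarrow> bool" where
  "absolutely_simple_group G \<Phi> \<longleftrightarrow>
     affine_group_scheme G \<and> of_finite_type G \<and> smooth_scheme G \<and>
     geom_connected G \<and> geom_semisimple G \<and> geom_nontrivial G \<and>
     root_system_of G \<Phi> \<and> irreducible_roots \<Phi>"


section \<open>The algebra of a Lie algebra\<close>

text \<open>
  A Lie algebra is given by its carrier \<open>L\<close>, a subspace of the type \<open>'v\<close>.
  An endomorphism of \<open>L\<close> is represented by a function that is \<open>0\<close> outside \<open>L\<close>.
\<close>

definition trace_on :: "('k::field \<Rightarrow> 'v::ab_group_add \<Rightarrow> 'v) \<Rightarrow> 'v set \<Rightarrow> ('v \<Rightarrow> 'v) \<Rightarrow> 'k" where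
  "trace_on scl L T =
     (let B = (SOME B. B \<subseteq> L \<and> \<not> Modules.module.dependent scl B \<and> Modules.module.span scl B = L)
      in \<Sum>b\<in>B. Modules.module.representation scl B (T b) b)"

context
  fixes scl :: "'k::field \<Rightarrow> 'v::ab_group_add \<Rightarrow> 'v"
    and L :: "'v set"
    and br :: "'v \<Rightarrow> 'v \<Rightarrow> 'v"
    and hv :: nat
begin

definition ad_map :: "'v \<Rightarrow> 'v \<Rightarrow> 'v" where
  "ad_map x = (\<lambda>z. if z \<in> L then br x z else 0)"

definition killing :: "'v \<Rightarrow> 'v \<Rightarrow> 'k" where
  "killing x y = trace_on scl L (ad_map x \<circ> ad_map y)"

definition end_scale :: "'k \<Rightarrow> ('v \<Rightarrow> 'v) \<Rightarrow> ('v \<Rightarrow> 'v)" where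
  "end_scale c T = (\<lambda>z. scl c (T z))"

definition jordan_prod :: "('v \<Rightarrow> 'v) \<Rightarrow> ('v \<Rightarrow> 'v) \<Rightarrow> ('v \<Rightarrow> 'v)" where
  "jordan_prod T U = end_scale (1 / 2) ((T \<circ> U) + (U \<circ> T))"

definition P_map :: "'v \<Rightarrow> 'v \<Rightarrow> ('v \<Rightarrow> 'v)" where
  "P_map x y =
     (\<lambda>z. if z \<in> L then scl (1 / 2) (scl (killing y z) x + scl (killing x z) y) else 0)"

definition S_map :: "'v \<Rightarrow> 'v \<Rightarrow> ('v \<Rightarrow> 'v)" where
  "S_map x y = end_scale (of_nat hv) (jordan_prod (ad_map x) (ad_map y)) + P_map x y"

text \<open>
  \<open>S_map x y\<close> is the value of the linear map \<open>S\<close> at the element \<open>xy\<close> of the symmetric square.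
  These elements span the symmetric square, hence the image of \<open>S\<close> is the following span.
\<close>

definition A_alg :: "('v \<Rightarrow> 'v) set" where
  "A_alg = Modules.module.span end_scale {S_map x y | x y. x \<in> L \<and> y \<in> L}"

definition diamond_formula :: "'v \<Rightarrow> 'v \<Rightarrow> 'v \<Rightarrow> 'v \<Rightarrow> ('v \<Rightarrow> 'v)" where
  "diamond_formula A B C D =
     end_scale (of_nat hv / 2)
       (S_map A (jordan_prod (ad_map C) (ad_map D) B) + S_map (jordan_prod (ad_map C) (ad_map D) A) B)
   + end_scale (of_nat hv / 2)
       (S_map C (jordan_prod (ad_map A) (ad_map B) D) + S_map (jordan_prod (ad_map A) (ad_map B) C) D)
   + end_scale (of_nat hv / 2)
       (S_map (br A C) (br B D) + S_map (br A D) (br B C))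
   + end_scale (1 / 4)
       (end_scale (killing A C) (S_map B D) + end_scale (killing A D) (S_map B C)
        + end_scale (killing B C) (S_map A D) + end_scale (killing B D) (S_map A C))"

definition is_diamond :: "(('v \<Rightarrow> 'v) \<Rightarrow> ('v \<Rightarrow> 'v) \<Rightarrow> ('v \<Rightarrow> 'v)) \<Rightarrow> bool" where
  "is_diamond m \<longleftrightarrow>
     (\<forall>a\<in>A_alg. \<forall>b\<in>A_alg. m a b \<in> A_alg \<and> m a b = m b a) \<and>
     (\<forall>a\<in>A_alg. \<forall>a'\<in>A_alg. \<forall>b\<in>A_alg. m (a + a') b = m a b + m a' b) \<and>
     (\<forall>c. \<forall>a\<in>A_alg. \<forall>b\<in>A_alg. m (end_scale c a) b = end_scale c (m a b)) \<and>
     (\<forall>A\<in>L. \<forall>B\<in>L. \<forall>C\<in>L. \<forall>D\<in>L. m (S_map A B) (S_map C D) = diamond_formula A B C D)"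

text \<open>The last conjunct only fixes the values outside \<open>A_alg\<close>, so that the map is unique.\<close>

definition diamond :: "('v \<Rightarrow> 'v) \<Rightarrow> ('v \<Rightarrow> 'v) \<Rightarrow> ('v \<Rightarrow> 'v)" where
  "diamond = (THE m. is_diamond m \<and> (\<forall>a b. a \<notin> A_alg \<or> b \<notin> A_alg \<longrightarrow> m a b = 0))"

end


section \<open>The algebra and the bilinear form of an algebraic group\<close>

context
  fixes G :: "('k::field, 'a::comm_ring_1) group_scheme"
    and \<Phi> :: "'e::euclidean_space set"
begin

definition group_alg :: "(('a \<Rightarrow> 'a) \<Rightarrow> ('a \<Rightarrow> 'a)) set" where
  "group_alg = A_alg (lie_scale G) (Lie G) lie_bracket (dual_coxeter_number \<Phi>)"

definition group_diamond :: "(('a \<Rightarrow> 'a) \<Rightarrow> ('a \<Rightarrow> 'a)) \<Rightarrow> (('a \<Rightarrow> 'a) \<Rightarrow> ('a \<Rightarrow> 'a)) \<Rightarrow>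
    (('a \<Rightarrow> 'a) \<Rightarrow> ('a \<Rightarrow> 'a))" where
  "group_diamond = diamond (lie_scale G) (Lie G) lie_bracket (dual_coxeter_number \<Phi>)"

definition group_tau ::
    "(('a \<Rightarrow> 'a) \<Rightarrow> ('a \<Rightarrow> 'a)) \<Rightarrow> (('a \<Rightarrow> 'a) \<Rightarrow> ('a \<Rightarrow> 'a)) \<Rightarrow> 'k" where
  "group_tau a a' =
     1 / of_nat (scheme_dim G) * trace_on (lie_scale G) (Lie G) (group_diamond a a')"

end

end

theory Submission
  imports Defs
begin

text \<open>
  Let the Lie algebra \<open>L\<close> act on \<open>End L\<close> by commutators.  Equivariance of
  \<open>S\<close> shows that \<open>S(AB) \<diamond> T\<close> equals
  \<open>1/2 (S(TA, B) + S(A, TB)) + h\<^sup>\<or>/4 (A\<cdot>(B\<cdot>T) + B\<cdot>(A\<cdot>T))\<close> for \<open>T = S(CD)\<close>.  This depends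
  linearly on the endomorphism \<open>T\<close> alone, so that, by symmetry, \<open>\<diamond>\<close> is well defined on the image
  of \<open>S\<close>.  Traces of commutators vanish and \<open>Tr S(XY)\<close> is a fixed multiple \<open>t K(X, Y)\<close>, hence
  \<open>Tr (S(AB) \<diamond> T) = t K(A, T B)\<close>.  Associativity of the trace form thus says that
  \<open>K(E, (S(CD) \<diamond> S(AB)) F)\<close> is invariant under exchanging \<open>AB\<close> with \<open>EF\<close>, which follows from
  the formula above, the self-adjointness of \<open>S(AB)\<close>, and \<open>K(A, S(CD) B) = K(C, S(AB) D)\<close>.
\<close>

section \<open>Traces on a subspace\<close>

locale vector_subspace = vector_space scl
  for scl :: "'k::field \<Rightarrow> 'v::ab_group_add \<Rightarrow> 'v" (infixr \<open>\<cdot>\<close> 75) +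
  fixes L :: "'v set"
  assumes subspace_L: "subspace L"
begin

lemma L_zero [simp]: "0 \<in> L"
  and L_add [simp]: "x \<in> L \<Longrightarrow> y \<in> L \<Longrightarrow> x + y \<in> L"
  and L_diff [simp]: "x \<in> L \<Longrightarrow> y \<in> L \<Longrightarrow> x - y \<in> L"
  and L_minus [simp]: "x \<in> L \<Longrightarrow> - x \<in> L"
  and L_scale [simp]: "x \<in> L \<Longrightarrow> c \<cdot> x \<in> L"
  using subspace_L
  by (simp_all add: subspace_0 subspace_add subspace_diff subspace_neg subspace_scale)

text \<open>The value 0 outside \<open>L\<close> makes endomorphisms that agree on \<open>L\<close>
  equal as functions, in accordance with \<open>ad_map\<close> and \<open>S_map\<close>.\<close>

definition endo :: "('v \<Rightarrow> 'v) \<Rightarrow> bool" where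
  "endo T \<longleftrightarrow> (\<forall>x\<in>L. T x \<in> L) \<and> (\<forall>x\<in>L. \<forall>y\<in>L. T (x + y) = T x + T y) \<and>
     (\<forall>c. \<forall>x\<in>L. T (c \<cdot> x) = c \<cdot> T x) \<and> (\<forall>z. z \<notin> L \<longrightarrow> T z = 0)"

lemma endoD:
  assumes "endo T"
  shows "x \<in> L \<Longrightarrow> T x \<in> L"
    and "x \<in> L \<Longrightarrow> y \<in> L \<Longrightarrow> T (x + y) = T x + T y"
    and "x \<in> L \<Longrightarrow> T (c \<cdot> x) = c \<cdot> T x"
    and "z \<notin> L \<Longrightarrow> T z = 0"
  using assms by (auto simp: endo_def)

lemma endo_zero: "endo T \<Longrightarrow> T 0 = 0"
  using endoD(3)[of T 0 0] by simp

lemma endo_comp: "endo T \<Longrightarrow> endo U \<Longrightarrow> endo (T \<circ> U)"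
  by (auto simp: endo_def endo_zero)

lemma endo_sum:
  assumes "endo T" "\<And>i. i \<in> I \<Longrightarrow> g i \<in> L"
  shows "T (\<Sum>i\<in>I. f i \<cdot> g i) = (\<Sum>i\<in>I. f i \<cdot> T (g i))"
  using assms(2)
  by (induction I rule: infinite_finite_induct)
    (simp_all add: endoD[OF assms(1)] endo_zero[OF assms(1)] subspace_L subspace_sum)

text \<open>Hides the choice made in \<open>trace_on\<close>: one basis serves all \<open>T\<close>
  at once. If it is infinite, every trace is a sum over an infinite set, which is 0 by
  convention.\<close>

lemma trace_on_basis:
  obtains B where "B \<subseteq> L" "independent B" "span B = L"
    "trace_on scl L = (\<lambda>T. \<Sum>b\<in>B. representation B (T b) b)"
proof -
  let ?P = "\<lambda>B. B \<subseteq> L \<and> independent B \<and> span B = L"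
  have "\<exists>B. ?P B"
    by (metis maximal_independent_subset span_minimal subset_antisym subspace_L)
  then have "?P (SOME B. ?P B)"
    by (rule someI_ex)
  then show ?thesis
    by (intro that[of "SOME B. ?P B"]) (auto simp: trace_on_def Let_def)
qed

text \<open>Linearity of the trace is proved for maps in \<open>L \<rightarrow> L\<close> rather
  than for \<open>endo\<close>, because the rank one maps in \<open>tr_S\<close> may be nonzero
  outside \<open>L\<close>.\<close>

lemma maps_add [simp]: "T \<in> L \<rightarrow> L \<Longrightarrow> U \<in> L \<rightarrow> L \<Longrightarrow> T + U \<in> L \<rightarrow> L"
  and maps_end_scale [simp]: "T \<in> L \<rightarrow> L \<Longrightarrow> end_scale scl c T \<in> L \<rightarrow> L"
  and maps_comp [simp]: "T \<in> L \<rightarrow> L \<Longrightarrow> U \<in> L \<rightarrow> L \<Longrightarrow> T \<circ> U \<in> L \<rightarrow> L"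
  by (simp_all add: end_scale_def Pi_iff)

lemma endo_maps: "endo T \<Longrightarrow> T \<in> L \<rightarrow> L"
  by (auto simp: endo_def)

lemma trace_on_add:
  assumes "T \<in> L \<rightarrow> L" "U \<in> L \<rightarrow> L"
  shows "trace_on scl L (T + U) = trace_on scl L T + trace_on scl L U"
proof -
  obtain B where "B \<subseteq> L" "independent B" "span B = L"
    and "trace_on scl L = (\<lambda>T. \<Sum>b\<in>B. representation B (T b) b)"
    using trace_on_basis .
  with assms show ?thesis
    by (simp add: representation_add Pi_iff subset_iff sum.distrib)
qed

lemma trace_on_end_scale:
  assumes "T \<in> L \<rightarrow> L"
  shows "trace_on scl L (end_scale scl c T) = c * trace_on scl L T"
proof -
  obtain B where "B \<subseteq> L" "independent B" "span B = L"
    and "trace_on scl L = (\<lambda>T. \<Sum>b\<in>B. representation B (T b) b)"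
    using trace_on_basis .
  with assms show ?thesis
    by (simp add: end_scale_def representation_scale Pi_iff subset_iff sum_distrib_left)
qed

lemma trace_on_diff:
  assumes "T \<in> L \<rightarrow> L" "U \<in> L \<rightarrow> L"
  shows "trace_on scl L (T - U) = trace_on scl L T - trace_on scl L U"
proof -
  have "T - U = T + end_scale scl (- 1) U"
    by (rule ext) (simp add: end_scale_def)
  then have "trace_on scl L (T - U) = trace_on scl L (T + end_scale scl (- 1) U)"
    by (rule arg_cong)
  with assms show ?thesis
    by (simp add: trace_on_add trace_on_end_scale del: minus_add_distrib)
qed

lemma trace_on_cong:
  assumes "\<And>x. x \<in> L \<Longrightarrow> T x = U x"
  shows "trace_on scl L T = trace_on scl L U"
proof -
  obtain B where "B \<subseteq> L" "independent B" "span B = L"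
    and "trace_on scl L = (\<lambda>T. \<Sum>b\<in>B. representation B (T b) b)"
    using trace_on_basis .
  with assms show ?thesis
    by (simp add: subset_iff)
qed

text \<open>For a finite basis both sides are the same double sum of products of matrix entries,
  summed in opposite orders; for an infinite one both are 0.\<close>

lemma trace_on_comp_commute:
  assumes T: "endo T" and U: "endo U"
  shows "trace_on scl L (T \<circ> U) = trace_on scl L (U \<circ> T)"
proof -
  obtain B where B: "B \<subseteq> L" "independent B" "span B = L"
    and tr: "trace_on scl L = (\<lambda>T. \<Sum>b\<in>B. representation B (T b) b)"
    using trace_on_basis .
  show ?thesis
  proof (cases "finite B")
    case True
    have *: "representation B (T (U b)) b
        = (\<Sum>c\<in>B. representation B (U b) c * representation B (T c) b)"
      if "b \<in> B" and T: "endo T" and U: "endo U" for b T U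
    proof -
      have "(\<Sum>c\<in>B. representation B (U b) c \<cdot> c) = U b"
        using sum_representation_eq[of B "U b" B] that B True
        by (simp add: endoD(1)[OF U] subset_iff)
      then have "T (U b) = (\<Sum>c\<in>B. representation B (U b) c \<cdot> T c)"
        using endo_sum[OF T, of B "\<lambda>c. c" "representation B (U b)"] B by (simp add: subset_iff)
      then show ?thesis
        using B T by (simp add: representation_sum representation_scale endoD(1) span_scale
            subset_iff)
    qed
    have "trace_on scl L (T \<circ> U) =
        (\<Sum>b\<in>B. \<Sum>c\<in>B. representation B (U b) c * representation B (T c) b)"
      by (simp add: tr *[OF _ T U])
    also have "\<dots> = (\<Sum>c\<in>B. \<Sum>b\<in>B. representation B (T c) b * representation B (U b) c)"
      by (subst sum.swap) (simp add: mult.commute)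
    also have "\<dots> = trace_on scl L (U \<circ> T)"
      by (simp add: tr *[OF _ U T])
    finally show ?thesis .
  qed (simp add: tr)
qed

text \<open>In infinite dimension every trace is the junk value \<open>0\<close>, hence the second assumption.\<close>

lemma trace_on_rank_one:
  assumes x: "x \<in> L"
    and f: "(\<And>T. trace_on scl L T = 0) \<Longrightarrow> f x = 0"
      "\<And>y z. y \<in> L \<Longrightarrow> z \<in> L \<Longrightarrow> f (y + z) = f y + f z"
      "\<And>c y. y \<in> L \<Longrightarrow> f (c \<cdot> y) = c * f y"
  shows "trace_on scl L (\<lambda>z. f z \<cdot> x) = f x"
proof -
  obtain B where B: "B \<subseteq> L" "independent B" "span B = L"
    and tr: "trace_on scl L = (\<lambda>T. \<Sum>b\<in>B. representation B (T b) b)"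
    using trace_on_basis .
  show ?thesis
  proof (cases "finite B")
    case True
    have f0: "f 0 = 0"
      using f(3)[of 0 0] by simp
    have fs: "f (\<Sum>c\<in>A. g c \<cdot> c) = (\<Sum>c\<in>A. g c * f c)" if "A \<subseteq> L" "finite A" for A g
      using that(2,1)
      by (induction A) (simp_all add: f0 f(2,3) subspace_L subspace_sum subset_iff)
    have "f x = (\<Sum>c\<in>B. representation B x c * f c)"
      using fs[OF B(1) True, of "representation B x"] sum_representation_eq[of B x B] B x True
      by simp
    also have "\<dots> = (\<Sum>b\<in>B. representation B (f b \<cdot> x) b)"
      using B x by (intro sum.cong) (simp_all add: representation_scale mult.commute)
    finally show ?thesis
      by (simp add: tr)
  next
    case False
    then show ?thesis
      using f(1) by (simp add: tr)
  qed
qed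

end


section \<open>The operators \<open>S\<close> on a Lie algebra\<close>

text \<open>Linearity is asked for in the second argument and carried over to the first by
  \<open>br_anti\<close>. The Jacobi identity has the form in which \<open>ad\<close> turns brackets
  into commutators. The parameter \<open>hv\<close> stands for the dual Coxeter number.\<close>

locale lie_algebra_on = vector_subspace scl L
  for scl :: "'k::field \<Rightarrow> 'v::ab_group_add \<Rightarrow> 'v" (infixr \<open>\<cdot>\<close> 75) and L :: "'v set" +
  fixes br :: "'v \<Rightarrow> 'v \<Rightarrow> 'v" and hv :: nat
  assumes br_closed [simp]: "x \<in> L \<Longrightarrow> y \<in> L \<Longrightarrow> br x y \<in> L"
    and br_add_right: "x \<in> L \<Longrightarrow> y \<in> L \<Longrightarrow> z \<in> L \<Longrightarrow> br x (y + z) = br x y + br x z"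
    and br_scale_right: "x \<in> L \<Longrightarrow> y \<in> L \<Longrightarrow> br x (c \<cdot> y) = c \<cdot> br x y"
    and br_anti: "x \<in> L \<Longrightarrow> y \<in> L \<Longrightarrow> br y x = - br x y"
    and br_br: "x \<in> L \<Longrightarrow> y \<in> L \<Longrightarrow> z \<in> L \<Longrightarrow> br (br x y) z = br x (br y z) - br y (br x z)"
begin

abbreviation ad where "ad \<equiv> ad_map L br"
abbreviation K where "K \<equiv> killing scl L br"
abbreviation tr where "tr \<equiv> trace_on scl L"
abbreviation es (infixr \<open>\<star>\<close> 75) where "es \<equiv> end_scale scl"
abbreviation S where "S \<equiv> S_map scl L br hv"
abbreviation "AA \<equiv> A_alg scl L br hv"

section \<open>The bracket and the invariance of the Killing form\<close>

lemma br_add_left: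
  assumes "x \<in> L" "y \<in> L" "z \<in> L"
  shows "br (x + y) z = br x z + br y z"
  using assms br_add_right[of z x y] by (simp add: br_anti[of z])

lemma br_scale_left: "x \<in> L \<Longrightarrow> y \<in> L \<Longrightarrow> br (c \<cdot> x) y = c \<cdot> br x y"
  using br_scale_right[of y x c] by (simp add: br_anti[of y])

lemma br_minus_right: "x \<in> L \<Longrightarrow> y \<in> L \<Longrightarrow> br x (- y) = - br x y"
  using br_scale_right[of x y "- 1"] by simp

lemma br_minus_left: "x \<in> L \<Longrightarrow> y \<in> L \<Longrightarrow> br (- x) y = - br x y"
  using br_scale_left[of x y "- 1"] by simp

lemma br_zero_right [simp]: "x \<in> L \<Longrightarrow> br x 0 = 0"
  using br_scale_right[of x 0 0] by simp

lemma br_diff_right: "x \<in> L \<Longrightarrow> y \<in> L \<Longrightarrow> z \<in> L \<Longrightarrow> br x (y - z) = br x y - br x z"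
  using br_add_right[of x y "- z"] by (simp add: br_minus_right)

lemmas br_linear = br_add_right br_scale_right br_minus_right br_diff_right
  br_add_left br_scale_left br_minus_left

lemma ad_apply [simp]: "x \<in> L \<Longrightarrow> y \<in> L \<Longrightarrow> ad x y = br x y"
  by (simp add: ad_map_def)

lemma ad_outside [simp]: "y \<notin> L \<Longrightarrow> ad x y = 0"
  by (simp add: ad_map_def)

lemma endo_ad: "x \<in> L \<Longrightarrow> endo (ad x)"
  by (auto simp: endo_def br_linear)

lemma K_add_right: "x \<in> L \<Longrightarrow> y \<in> L \<Longrightarrow> z \<in> L \<Longrightarrow> K x (y + z) = K x y + K x z"
  unfolding killing_def
  by (subst trace_on_add[symmetric])
    (auto intro!: trace_on_cong maps_comp endo_maps endo_ad simp: br_linear)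

lemma K_scale_right: "x \<in> L \<Longrightarrow> y \<in> L \<Longrightarrow> K x (c \<cdot> y) = c * K x y"
  unfolding killing_def
  by (subst trace_on_end_scale[symmetric])
    (auto intro!: trace_on_cong maps_comp endo_maps endo_ad simp: end_scale_def br_linear)

lemma K_sym: "x \<in> L \<Longrightarrow> y \<in> L \<Longrightarrow> K x y = K y x"
  by (simp add: killing_def endo_ad trace_on_comp_commute)

lemma K_add_left: "x \<in> L \<Longrightarrow> y \<in> L \<Longrightarrow> z \<in> L \<Longrightarrow> K (x + y) z = K x z + K y z"
  by (simp add: K_sym[of _ z] K_add_right)

lemma K_scale_left: "x \<in> L \<Longrightarrow> y \<in> L \<Longrightarrow> K (c \<cdot> x) y = c * K x y"
  by (simp add: K_sym[of _ y] K_scale_right)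

lemma K_minus_right: "x \<in> L \<Longrightarrow> y \<in> L \<Longrightarrow> K x (- y) = - K x y"
  using K_scale_right[of x y "- 1"] by simp

lemma K_minus_left: "x \<in> L \<Longrightarrow> y \<in> L \<Longrightarrow> K (- x) y = - K x y"
  using K_scale_left[of x y "- 1"] by simp

lemma K_diff_right: "x \<in> L \<Longrightarrow> y \<in> L \<Longrightarrow> z \<in> L \<Longrightarrow> K x (y - z) = K x y - K x z"
  using K_add_right[of x y "- z"] by (simp add: K_minus_right)

lemmas K_linear = K_add_right K_scale_right K_minus_right K_diff_right
  K_add_left K_scale_left K_minus_left

text \<open>Invariance of the Killing form, written as skewness of \<open>ad x\<close>. It rests on
  cyclicity of the trace.\<close>

lemma K_br:
  assumes x: "x \<in> L" and y: "y \<in> L" and z: "z \<in> L"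
  shows "K (br x y) z = - K y (br x z)"
proof -
  note endos = endo_comp endo_ad x y z
  have 1: "ad (br u v) \<circ> ad w = (ad u \<circ> (ad v \<circ> ad w)) - (ad v \<circ> (ad u \<circ> ad w))"
    if "u \<in> L" "v \<in> L" "w \<in> L" for u v w
    using that by (intro ext; rename_tac t; case_tac "t \<in> L")
      (auto simp: br_br br_linear)
  have 2: "K (br u v) w = tr (ad u \<circ> (ad v \<circ> ad w)) - tr (ad v \<circ> (ad u \<circ> ad w))"
    if "u \<in> L" "v \<in> L" "w \<in> L" for u v w
    using that unfolding killing_def 1[OF that]
    by (simp add: trace_on_diff endo_maps endo_ad)
  \<comment> \<open>Rotating both triple products produces the two terms of
    \<open>K (br x z) y\<close> with the signs exchanged.\<close>
  have "tr (ad y \<circ> (ad x \<circ> ad z)) = tr (ad x \<circ> (ad z \<circ> ad y))"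
    using trace_on_comp_commute[of "ad y" "ad x \<circ> ad z"] endos by (simp add: comp_assoc)
  moreover have "tr (ad x \<circ> (ad y \<circ> ad z)) = tr (ad z \<circ> (ad x \<circ> ad y))"
    using trace_on_comp_commute[of "ad x \<circ> ad y" "ad z"] endos by (simp add: comp_assoc)
  ultimately have "K (br x y) z = - K (br x z) y"
    using 2[OF x y z] 2[OF x z y] by simp
  then show ?thesis
    using x y z by (simp add: K_sym)
qed

section \<open>Bilinearity, equivariance and self-adjointness of S\<close>

sublocale es: vector_space es
  by unfold_locales (auto simp: end_scale_def scale_right_distrib scale_left_distrib)

lemma S_apply:
  assumes "x \<in> L" "y \<in> L" "z \<in> L"
  shows "S x y z = (of_nat hv / 2) \<cdot> (br x (br y z) + br y (br x z))
    + (1 / 2) \<cdot> (K y z \<cdot> x + K x z \<cdot> y)"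
  using assms by (simp add: S_map_def P_map_def jordan_prod_def end_scale_def)

lemma S_outside [simp]: "x \<in> L \<Longrightarrow> y \<in> L \<Longrightarrow> z \<notin> L \<Longrightarrow> S x y z = 0"
  by (simp add: S_map_def P_map_def jordan_prod_def end_scale_def)

lemma ext_on_L:
  assumes "\<And>z. z \<in> L \<Longrightarrow> T z = U z" "\<And>z. z \<notin> L \<Longrightarrow> T z = 0" "\<And>z. z \<notin> L \<Longrightarrow> U z = 0"
  shows "T = (U :: 'v \<Rightarrow> 'v)"
  using assms by (metis ext)

lemma S_closed [simp]: "x \<in> L \<Longrightarrow> y \<in> L \<Longrightarrow> z \<in> L \<Longrightarrow> S x y z \<in> L"
  by (simp add: S_apply)

lemma S_sym: "x \<in> L \<Longrightarrow> y \<in> L \<Longrightarrow> S x y = S y x"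
  by (rule ext_on_L) (simp_all add: S_apply add.commute)

lemma endo_S: "x \<in> L \<Longrightarrow> y \<in> L \<Longrightarrow> endo (S x y)"
  unfolding endo_def by (auto simp: S_apply br_linear K_linear algebra_simps)

lemma S_add_right: "x \<in> L \<Longrightarrow> y \<in> L \<Longrightarrow> z \<in> L \<Longrightarrow> S x (y + z) = S x y + S x z"
  by (rule ext_on_L) (simp_all add: S_apply br_linear K_linear algebra_simps)

lemma S_scale_right: "x \<in> L \<Longrightarrow> y \<in> L \<Longrightarrow> S x (c \<cdot> y) = c \<star> S x y"
  by (rule ext_on_L) (simp_all add: S_apply br_linear K_linear end_scale_def algebra_simps)

lemma S_add_left: "x \<in> L \<Longrightarrow> y \<in> L \<Longrightarrow> z \<in> L \<Longrightarrow> S (x + y) z = S x z + S y z"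
  by (simp add: S_sym[of _ z] S_add_right)

lemma S_scale_left: "x \<in> L \<Longrightarrow> y \<in> L \<Longrightarrow> S (c \<cdot> x) y = c \<star> S x y"
  by (simp add: S_sym[of _ y] S_scale_right)

lemma S_minus_right: "x \<in> L \<Longrightarrow> y \<in> L \<Longrightarrow> S x (- y) = - S x y"
  using S_scale_right[of x y "- 1"] by simp

lemma S_minus_left: "x \<in> L \<Longrightarrow> y \<in> L \<Longrightarrow> S (- x) y = - S x y"
  using S_scale_left[of x y "- 1"] by simp

lemmas S_linear = S_add_right S_scale_right S_minus_right S_add_left S_scale_left S_minus_left

definition act :: "'v \<Rightarrow> ('v \<Rightarrow> 'v) \<Rightarrow> ('v \<Rightarrow> 'v)" where
  "act x T = (ad x \<circ> T) - (T \<circ> ad x)"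

text \<open>\<open>ad x\<close> is a derivation of the bracket and skew for \<open>K\<close>, so
  both summands of \<open>S\<close> are equivariant.\<close>

lemma act_S:
  assumes "x \<in> L" "a \<in> L" "b \<in> L"
  shows "act x (S a b) = S (br x a) b + S a (br x b)"
proof (rule ext_on_L)
  show "act x (S a b) z = (S (br x a) b + S a (br x b)) z" if "z \<in> L" for z
    using assms that
    by (simp add: act_def S_apply br_linear br_br K_br K_linear algebra_simps)
qed (use assms in \<open>auto simp: act_def endo_zero[OF endo_S]\<close>)

lemma act_add:
  "x \<in> L \<Longrightarrow> endo T \<Longrightarrow> endo U \<Longrightarrow> act x (T + U) = act x T + act x U"
  by (rule ext_on_L) (auto simp: act_def br_linear endoD endo_zero)

text \<open>\<open>ad a\<close> and \<open>ad b\<close> are skew for \<open>K\<close>, so moving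
  their product across \<open>K\<close> only reverses the two factors, and \<open>S\<close> contains
  both orders. The remaining summand is self-adjoint by symmetry of \<open>K\<close>.\<close>

lemma K_S:
  assumes "a \<in> L" "b \<in> L" "x \<in> L" "y \<in> L"
  shows "K (S a b x) y = K x (S a b y)"
proof -
  have 1: "K (br a (br b x)) y = K x (br b (br a y))"
    and 2: "K (br b (br a x)) y = K x (br a (br b y))"
    using assms by (simp_all add: K_br)
  show ?thesis
    using assms by (simp add: S_apply 1 2 K_linear K_sym[of y] K_sym[of x] algebra_simps)
qed

text \<open>By invariance the bracket terms are \<open>- K (br x a) (br y b)\<close> and
  \<open>- K (br y a) (br x b)\<close>, each unchanged when both of its brackets are reversed. The
  other terms are products of two values of \<open>K\<close> and are permuted.\<close>

lemma K_S_swap: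
  assumes "a \<in> L" "b \<in> L" "x \<in> L" "y \<in> L"
  shows "K a (S x y b) = K x (S a b y)"
proof -
  have flip: "K u (br v w) = - K (br v u) w" if "u \<in> L" "v \<in> L" "w \<in> L" for u v w
    using that by (simp add: K_br)
  have comm: "K u (br v (br w z)) = K v (br u (br z w))"
    if "u \<in> L" "v \<in> L" "w \<in> L" "z \<in> L" for u v w z
  proof -
    have "K u (br v (br w z)) = - K (br v u) (br w z)" "K v (br u (br z w)) = - K (br u v) (br z w)"
      using that by (auto intro!: flip)
    then show ?thesis
      using that br_anti[of u v] br_anti[of w z] by (simp add: K_linear)
  qed
  have 1: "K a (br x (br y b)) = K x (br a (br b y))"
    using assms by (simp add: comm)
  have 2: "K a (br y (br x b)) = K x (br b (br a y))"
    using assms by (simp add: flip[of a] flip[of x] K_sym[of "br b x"])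
      (simp add: br_anti[of a y] br_anti[of b x] K_linear K_sym[of "br b x"])
  show ?thesis
    using assms by (simp add: S_apply 1 2 K_linear)
      (simp add: K_sym[of a] K_sym[of b] algebra_simps)
qed

section \<open>Multiplication by S(ab) as an operator on endomorphisms\<close>

definition dia :: "'v \<Rightarrow> 'v \<Rightarrow> ('v \<Rightarrow> 'v) \<Rightarrow> ('v \<Rightarrow> 'v)" where
  "dia a b T = (1 / 2) \<star> (S (T a) b + S a (T b))
     + (of_nat hv / 4) \<star> (act a (act b T) + act b (act a T))"

text \<open>In characteristic 2 both sides are 0, because division by zero yields 0.\<close>

lemma quarter_add_quarter: "1 / 4 + 1 / 4 = (1 / 2 :: 'k)"
proof (cases "(2 :: 'k) = 0")
  case True
  then have "(4 :: 'k) = 0"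
    by (metis mult_zero_left numeral_Bit0_eq_double)
  with True show ?thesis by simp
next
  case False
  moreover from this have "(4 :: 'k) \<noteq> 0"
    by (metis mult_2 mult_eq_0_iff numeral_Bit0)
  ultimately show ?thesis by (simp add: field_simps)
qed

text \<open>Inserting \<open>S c d\<close> into \<open>S (T a) b + S a (T b)\<close> gives the first
  and the last line of the formula. The two iterated actions give eight terms by
  \<open>act_S\<close>: four form the second line, the other four the third.\<close>

lemma dia_S:
  assumes "a \<in> L" "b \<in> L" "c \<in> L" "d \<in> L"
  shows "dia a b (S c d) = diamond_formula scl L br hv a b c d"
proof -
  define p :: 'k where "p = 1 / 2"
  define H :: 'k where "H = of_nat hv"
  have pp: "p * p + p * p = p"
    using quarter_add_quarter by (simp add: p_def)
  \<comment> \<open>Each term of the third line arises twice with coefficient \<open>hv / 4\<close>,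
    but stands in the formula once with \<open>hv / 2\<close>.\<close>
  have split_cross: "(H * p) \<star> T = (H * (p * p)) \<star> T + (H * (p * p)) \<star> T" for T
    by (subst pp[symmetric]) (simp only: es.scale_left_distrib distrib_left)
  have j: "jordan_prod scl (ad x) (ad y) z = p \<cdot> (br x (br y z) + br y (br x z))"
    if "x \<in> L" "y \<in> L" "z \<in> L" for x y z
    using that by (simp add: jordan_prod_def end_scale_def p_def)
  have Sc: "S c d z = (H * p) \<cdot> (br c (br d z) + br d (br c z)) + p \<cdot> (K d z \<cdot> c + K c z \<cdot> d)"
    if "z \<in> L" for z
    using that assms by (simp add: S_apply p_def H_def)
  have "dia a b (S c d) = p \<star> (S (S c d a) b + S a (S c d b))
      + (H * (p * p)) \<star> (S (br a (br b c)) d + S (br b c) (br a d) + S (br a c) (br b d)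
          + S c (br a (br b d)) + S (br b (br a c)) d + S (br a c) (br b d) + S (br b c) (br a d)
          + S c (br b (br a d)))"
    using assms unfolding dia_def p_def H_def by (simp add: act_S act_add endo_S add_ac)
  also have "\<dots> = (H * p) \<star> (S a (p \<cdot> (br c (br d b) + br d (br c b)))
          + S (p \<cdot> (br c (br d a) + br d (br c a))) b)
      + (H * p) \<star> (S c (p \<cdot> (br a (br b d) + br b (br a d)))
          + S (p \<cdot> (br a (br b c) + br b (br a c))) d)
      + (H * p) \<star> (S (br a c) (br b d) + S (br a d) (br b c))
      + (p * p) \<star> (K a c \<star> S b d + K a d \<star> S b c + K b c \<star> S a d + K b d \<star> S a c)"
    using assms
    by (simp add: Sc S_linear es.scale_right_distrib
        split_cross[of "S (br a c) (br b d)"] split_cross[of "S (br a d) (br b c)"]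
        K_sym[of d] K_sym[of c] S_sym[of "br b c"] S_sym[of d b] S_sym[of c b] mult_ac add_ac)
  also have "\<dots> = diamond_formula scl L br hv a b c d"
    using assms unfolding diamond_formula_def by (simp add: j p_def H_def)
  finally show ?thesis .
qed

text \<open>Exchanging the pairs swaps the first two lines of the formula and reverses both brackets
  in each term of the third, so that the signs cancel. This symmetry is the source of
  well-definedness.\<close>

lemma dia_S_commute:
  assumes "a \<in> L" "b \<in> L" "c \<in> L" "d \<in> L"
  shows "dia a b (S c d) = dia c d (S a b)"
proof -
  have "S (br c a) (br d b) = S (br a c) (br b d)" "S (br c b) (br d a) = S (br a d) (br b c)"
    using assms br_anti[of a c] br_anti[of b d] br_anti[of b c] br_anti[of a d]
    by (simp_all add: S_linear S_sym[of "br b c"])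
  moreover have "K c a = K a c" "K d a = K a d" "K c b = K b c" "K d b = K b d"
    "S c a = S a c" "S d a = S a d" "S c b = S b c" "S d b = S b d"
    using assms by (simp_all add: K_sym S_sym)
  ultimately show ?thesis
    using assms by (simp add: dia_S diamond_formula_def add_ac)
qed

lemma act_scale: "x \<in> L \<Longrightarrow> endo T \<Longrightarrow> act x (c \<star> T) = c \<star> act x T"
  by (rule ext_on_L) (auto simp: act_def br_linear endoD endo_zero end_scale_def scale_right_diff_distrib)

lemma endo_add: "endo T \<Longrightarrow> endo U \<Longrightarrow> endo (T + U)"
  by (auto simp: endo_def scale_right_distrib)

lemma endo_es: "endo T \<Longrightarrow> endo (c \<star> T)"
  by (auto simp: endo_def end_scale_def scale_right_distrib mult.commute)

lemma endo_0: "endo 0"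
  by (auto simp: endo_def)

lemma endo_act: "x \<in> L \<Longrightarrow> endo T \<Longrightarrow> endo (act x T)"
  using endo_zero[of T] unfolding endo_def act_def
  by (auto simp: br_linear scale_right_diff_distrib)

lemma dia_add:
  assumes "a \<in> L" "b \<in> L" "endo T" "endo U"
  shows "dia a b (T + U) = dia a b T + dia a b U"
  using assms by (simp add: dia_def act_add endo_act endoD S_linear es.scale_right_distrib add_ac)

lemma dia_scale:
  assumes "a \<in> L" "b \<in> L" "endo T"
  shows "dia a b (c \<star> T) = c \<star> dia a b T"
proof -
  have "(c \<star> T) z = c \<cdot> T z" for z
    by (simp add: end_scale_def)
  then show ?thesis
    using assms
    by (simp add: dia_def act_scale endo_act endoD S_linear es.scale_right_distrib mult.commute)
qed

lemma dia_zero: "a \<in> L \<Longrightarrow> b \<in> L \<Longrightarrow> dia a b 0 = 0"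
  using dia_scale[of a b 0 0] by (simp add: endo_0)

section \<open>Construction and uniqueness of the product on A(L)\<close>

text \<open>Induction rules produce eta-long functions, which these rules would rewrite pointwise.\<close>

lemmas [simp del] = plus_fun_apply zero_fun_apply

text \<open>The step keeps \<open>y \<in> AA\<close> at hand, since \<diamond> is known to be
  bilinear only on \<open>AA\<close>.\<close>

lemma A_induct [consumes 1, case_names zero add]:
  assumes "x \<in> AA" "Q 0"
    and "\<And>c a b y. a \<in> L \<Longrightarrow> b \<in> L \<Longrightarrow> y \<in> AA \<Longrightarrow> Q y \<Longrightarrow> Q (c \<star> S a b + y)"
  shows "Q x"
proof -
  let ?G = "{S x y | x y. x \<in> L \<and> y \<in> L}"
  have "x \<in> es.span ?G"
    using assms(1) by (simp add: A_alg_def)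
  then have "Q x \<and> x \<in> es.span ?G"
  proof (induction rule: es.span_induct_alt)
    case (step c x y)
    then obtain a b where "x = S a b" "a \<in> L" "b \<in> L"
      by blast
    with step show ?case
      using assms(3)[of a b y c] unfolding A_alg_def
      by (simp add: es.span_add es.span_scale es.span_base)
  qed (simp add: assms(2) es.span_zero)
  then show ?thesis ..
qed

lemma A_S [simp]: "x \<in> L \<Longrightarrow> y \<in> L \<Longrightarrow> S x y \<in> AA"
  unfolding A_alg_def by (auto intro!: es.span_base)

lemma A_zero [simp]: "0 \<in> AA"
  and A_add [simp]: "x \<in> AA \<Longrightarrow> y \<in> AA \<Longrightarrow> x + y \<in> AA"
  and A_scale [simp]: "x \<in> AA \<Longrightarrow> c \<star> x \<in> AA"
  unfolding A_alg_def by (auto intro: es.span_zero es.span_add es.span_scale)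

lemma endo_A: "x \<in> AA \<Longrightarrow> endo x"
  by (induction rule: A_induct) (simp_all add: endo_0 endo_add endo_es endo_S)

text \<open>By equivariance, commutators with \<open>ad a\<close> send each \<open>S c d\<close> to
  a sum of such operators.\<close>

lemma dia_A:
  assumes "x \<in> AA" and ab: "a \<in> L" "b \<in> L"
  shows "dia a b x \<in> AA"
  using assms(1)
proof (induction rule: A_induct)
  case (add c a' b' y)
  have "dia a b (S a' b') \<in> AA"
    using add ab unfolding dia_def by (simp add: act_S act_add endo_S)
  with add ab show ?case
    by (simp add: dia_add dia_scale endo_es endo_S endo_A)
qed (simp_all add: dia_zero ab)

text \<open>A list of pairs plays the role of an element of the symmetric square. No coefficients
  are stored: a scalar can be absorbed into the first entry of a pair.\<close>

definition S_sum :: "('v \<times> 'v) list \<Rightarrow> ('v \<Rightarrow> 'v)" where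
  "S_sum ps = (\<Sum>(a, b)\<leftarrow>ps. S a b)"

text \<open>A priori this depends on the list itself and not only on the operator
  \<open>S_sum ps\<close>.\<close>

definition dia_sum :: "('v \<times> 'v) list \<Rightarrow> ('v \<Rightarrow> 'v) \<Rightarrow> ('v \<Rightarrow> 'v)" where
  "dia_sum ps T = (\<Sum>(a, b)\<leftarrow>ps. dia a b T)"

lemma S_sum_A: "set ps \<subseteq> L \<times> L \<Longrightarrow> S_sum ps \<in> AA"
  by (induction ps) (auto simp: S_sum_def)

lemma A_S_sum: "x \<in> AA \<Longrightarrow> \<exists>ps. set ps \<subseteq> L \<times> L \<and> S_sum ps = x"
proof (induction rule: A_induct)
  case zero
  show ?case by (intro exI[of _ "[]"]) (simp add: S_sum_def)
next
  case (add c a b y)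
  then obtain ps where "set ps \<subseteq> L \<times> L" "S_sum ps = y" by blast
  with add show ?case
    by (intro exI[of _ "(c \<cdot> a, b) # ps"]) (simp add: S_sum_def S_linear)
qed

lemma dia_sum_add:
  assumes "set ps \<subseteq> L \<times> L" "endo T" "endo U"
  shows "dia_sum ps (T + U) = dia_sum ps T + dia_sum ps U"
  using assms(1) by (induction ps) (auto simp: dia_sum_def dia_add assms(2,3) add_ac)

lemma dia_sum_scale:
  assumes "set ps \<subseteq> L \<times> L" "endo T"
  shows "dia_sum ps (c \<star> T) = c \<star> dia_sum ps T"
  using assms(1)
  by (induction ps) (auto simp: dia_sum_def dia_scale assms(2) es.scale_right_distrib)

lemma dia_sum_A: "set ps \<subseteq> L \<times> L \<Longrightarrow> x \<in> AA \<Longrightarrow> dia_sum ps x \<in> AA"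
  by (induction ps) (auto simp: dia_sum_def dia_A)

lemma dia_S_sum:
  assumes "a \<in> L" "b \<in> L" "set ps \<subseteq> L \<times> L"
  shows "dia a b (S_sum ps) = dia_sum ps (S a b)"
  using assms(3)
proof (induction ps)
  case (Cons p ps)
  obtain c d where p: "p = (c, d)" by force
  with Cons.prems assms(1,2) have "dia a b (S c d + S_sum ps) = dia c d (S a b) + dia a b (S_sum ps)"
    by (simp add: dia_add endo_S endo_A S_sum_A dia_S_commute)
  with Cons p show ?case
    by (simp add: S_sum_def dia_sum_def)
qed (use assms in \<open>simp add: S_sum_def dia_sum_def dia_zero\<close>)

text \<open>The left side sees \<open>qs\<close> only through \<open>S_sum qs\<close>, the right
  side sees \<open>ps\<close> only through \<open>S_sum ps\<close>. Hence the product depends on the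
  two operators alone, and any choice of lists will do.\<close>

lemma dia_sum_S_sum:
  assumes "set ps \<subseteq> L \<times> L" "set qs \<subseteq> L \<times> L"
  shows "dia_sum ps (S_sum qs) = dia_sum qs (S_sum ps)"
  using assms(1)
proof (induction ps)
  case Nil
  have "dia_sum qs (0 \<star> 0) = 0"
    by (subst dia_sum_scale) (simp_all add: assms endo_0)
  then show ?case
    by (simp add: S_sum_def dia_sum_def)
next
  case (Cons p ps)
  obtain a b where p: "p = (a, b)" by force
  with Cons.prems assms(2) have "dia_sum qs (S a b + S_sum ps) = dia a b (S_sum qs) + dia_sum qs (S_sum ps)"
    by (simp add: dia_sum_add endo_S endo_A S_sum_A dia_S_sum)
  with Cons p show ?case
    by (simp add: S_sum_def dia_sum_def)
qed

definition S_rep :: "('v \<Rightarrow> 'v) \<Rightarrow> ('v \<times> 'v) list" where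
  "S_rep x = (SOME ps. set ps \<subseteq> L \<times> L \<and> S_sum ps = x)"

lemma S_rep: "x \<in> AA \<Longrightarrow> set (S_rep x) \<subseteq> L \<times> L" "x \<in> AA \<Longrightarrow> S_sum (S_rep x) = x"
  using someI_ex[OF A_S_sum[of x]] by (simp_all add: S_rep_def)

text \<open>Linearity in the second factor is built into \<open>dia_sum\<close>. Commutativity
  carries it over to the first factor, where \<open>S_rep\<close> is not additive in
  general.\<close>

lemma is_diamond_dia_sum:
  "is_diamond scl L br hv (\<lambda>x y. if x \<in> AA \<and> y \<in> AA then dia_sum (S_rep x) y else 0)"
    (is "is_diamond _ _ _ _ ?m")
proof -
  have closed: "?m x y \<in> AA" if "x \<in> AA" "y \<in> AA" for x y
    using that by (simp add: dia_sum_A S_rep(1))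
  have comm: "?m x y = ?m y x" if "x \<in> AA" "y \<in> AA" for x y
    using dia_sum_S_sum[of "S_rep x" "S_rep y"] that by (simp add: S_rep)
  have add: "?m (x + x') y = ?m x y + ?m x' y" if "x \<in> AA" "x' \<in> AA" "y \<in> AA" for x x' y
  proof -
    have "?m y (x + x') = ?m y x + ?m y x'"
      using that by (simp add: dia_sum_add S_rep endo_A)
    then show ?thesis
      using comm[of x y] comm[of x' y] comm[of "x + x'" y] that by simp
  qed
  have scale: "?m (c \<star> x) y = c \<star> ?m x y" if "x \<in> AA" "y \<in> AA" for c x y
  proof -
    have "?m y (c \<star> x) = c \<star> ?m y x"
      using that by (simp add: dia_sum_scale S_rep endo_A)
    then show ?thesis
      using comm[of x y] comm[of "c \<star> x" y] that by simp
  qed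
  have diamond: "?m (S a b) (S c d) = diamond_formula scl L br hv a b c d"
    if "a \<in> L" "b \<in> L" "c \<in> L" "d \<in> L" for a b c d
  proof -
    \<comment> \<open>The list \<open>S_rep (S a b)\<close> need not be \<open>[(a, b)]\<close>.
      After the exchange, \<open>dia_S_sum\<close> replaces the list chosen for \<open>S c d\<close>
      by the operator \<open>dia a b\<close>.\<close>
    have "?m (S a b) (S c d) = ?m (S c d) (S a b)"
      using that by (intro comm) simp_all
    also have "\<dots> = dia a b (S c d)"
      using that dia_S_sum[of a b "S_rep (S c d)"] by (simp add: S_rep)
    finally show ?thesis
      using that by (simp add: dia_S)
  qed
  show ?thesis
    unfolding is_diamond_def
    by (intro conjI ballI allI;
        (rule add | rule scale | rule comm | rule closed | rule diamond); assumption)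
qed

lemma is_diamondD:
  assumes "is_diamond scl L br hv m"
  shows "x \<in> AA \<Longrightarrow> y \<in> AA \<Longrightarrow> m x y \<in> AA"
    and "x \<in> AA \<Longrightarrow> y \<in> AA \<Longrightarrow> m x y = m y x"
    and "x \<in> AA \<Longrightarrow> x' \<in> AA \<Longrightarrow> y \<in> AA \<Longrightarrow> m (x + x') y = m x y + m x' y"
    and "x \<in> AA \<Longrightarrow> y \<in> AA \<Longrightarrow> m (c \<star> x) y = c \<star> m x y"
    and "a \<in> L \<Longrightarrow> b \<in> L \<Longrightarrow> a' \<in> L \<Longrightarrow> b' \<in> L \<Longrightarrow> m (S a b) (S a' b') = dia a b (S a' b')"
proof -
  show "x \<in> AA \<Longrightarrow> y \<in> AA \<Longrightarrow> m x y \<in> AA" "x \<in> AA \<Longrightarrow> y \<in> AA \<Longrightarrow> m x y = m y x"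
    using assms unfolding is_diamond_def by blast+
  show "x \<in> AA \<Longrightarrow> x' \<in> AA \<Longrightarrow> y \<in> AA \<Longrightarrow> m (x + x') y = m x y + m x' y"
    using assms unfolding is_diamond_def by blast
  show "x \<in> AA \<Longrightarrow> y \<in> AA \<Longrightarrow> m (c \<star> x) y = c \<star> m x y"
    using assms unfolding is_diamond_def by blast
  show "m (S a b) (S a' b') = dia a b (S a' b')" if "a \<in> L" "b \<in> L" "a' \<in> L" "b' \<in> L"
    using assms that unfolding is_diamond_def by (simp add: dia_S)
qed

text \<open>Both maps agree on generators; one induction in each argument extends this, with
  commutativity in between.\<close>

lemma is_diamond_unique:
  assumes m: "is_diamond scl L br hv m" and m': "is_diamond scl L br hv m'"
    and "x \<in> AA" "y \<in> AA"
  shows "m x y = m' x y"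
proof -
  have m_zero: "m 0 y = 0" if "is_diamond scl L br hv m" "y \<in> AA" for m y
  proof -
    have "m (0 \<star> 0) y = 0 \<star> m 0 y"
      using that(2) by (rule is_diamondD(4)[OF that(1) A_zero])
    then show ?thesis by simp
  qed
  have step: "m (c \<star> S a b + z) y = c \<star> m (S a b) y + m z y"
    if "is_diamond scl L br hv m" and "a \<in> L" "b \<in> L" "z \<in> AA" "y \<in> AA" for m a b c z y
    using that by (simp add: is_diamondD(3,4)[OF that(1)])
  have comm: "m x y = m y x" if "is_diamond scl L br hv m" "x \<in> AA" "y \<in> AA" for m x y
    using that(2,3) by (rule is_diamondD(2)[OF that(1)])
  have "m y (S a b) = m' y (S a b)" if "a \<in> L" "b \<in> L" for a b
    using assms(4)
  proof (induction rule: A_induct)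
    case zero
    show ?case
      using that by (simp add: m_zero[OF m] m_zero[OF m'])
  next
    case (add c a' b' z)
    have "m (S a' b') (S a b) = m' (S a' b') (S a b)"
      using add that by (simp add: is_diamondD(5)[OF m] is_diamondD(5)[OF m'])
    with add that show ?case
      by (simp add: step[OF m] step[OF m'])
  qed
  then have gen: "m (S a b) y = m' (S a b) y" if "a \<in> L" "b \<in> L" for a b
    using that assms(4) by (simp add: comm[OF m, of _ y] comm[OF m', of _ y])
  show ?thesis
    using assms(3)
  proof (induction rule: A_induct)
    case zero
    show ?case
      using assms(4) by (simp add: m_zero[OF m] m_zero[OF m'])
  next
    case (add c a b z)
    with assms(4) show ?case
      by (simp add: step[OF m] step[OF m'] gen)
  qed
qed

section \<open>The product as a definite description\<close>

abbreviation D (infixl \<open>\<diamond>\<close> 70) where "D \<equiv> diamond scl L br hv"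

text \<open>The description \<open>THE\<close> denotes something useful only if the map exists and
  is unique as a total function; this is why its values off \<open>AA\<close> are set to 0.\<close>

lemma is_diamond_diamond: "is_diamond scl L br hv D"
proof -
  let ?Q = "\<lambda>m. is_diamond scl L br hv m \<and> (\<forall>x y. x \<notin> AA \<or> y \<notin> AA \<longrightarrow> m x y = 0)"
  let ?m = "\<lambda>x y. if x \<in> AA \<and> y \<in> AA then dia_sum (S_rep x) y else 0"
  have "?Q ?m"
    using is_diamond_dia_sum by simp
  moreover have "m = ?m" if "?Q m" for m
  proof (rule ext, rule ext)
    show "m x y = ?m x y" for x y
      using is_diamond_unique[of m ?m x y] that \<open>?Q ?m\<close> by (cases "x \<in> AA \<and> y \<in> AA") auto
  qed
  ultimately have "\<exists>!m. ?Q m"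
    by (rule ex1I)
  then have "?Q (THE m. ?Q m)"
    by (rule theI')
  then show ?thesis
    by (simp add: diamond_def)
qed

lemma D_closed [simp]: "x \<in> AA \<Longrightarrow> y \<in> AA \<Longrightarrow> x \<diamond> y \<in> AA"
  and D_commute: "x \<in> AA \<Longrightarrow> y \<in> AA \<Longrightarrow> x \<diamond> y = y \<diamond> x"
  and D_add_left: "x \<in> AA \<Longrightarrow> x' \<in> AA \<Longrightarrow> y \<in> AA \<Longrightarrow> (x + x') \<diamond> y = x \<diamond> y + x' \<diamond> y"
  and D_scale_left: "x \<in> AA \<Longrightarrow> y \<in> AA \<Longrightarrow> (c \<star> x) \<diamond> y = c \<star> (x \<diamond> y)"
  and D_S_S: "a \<in> L \<Longrightarrow> b \<in> L \<Longrightarrow> a' \<in> L \<Longrightarrow> b' \<in> L \<Longrightarrow> S a b \<diamond> S a' b' = dia a b (S a' b')"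
  using is_diamondD[OF is_diamond_diamond] by simp_all

lemma D_add_right: "x \<in> AA \<Longrightarrow> y \<in> AA \<Longrightarrow> y' \<in> AA \<Longrightarrow> x \<diamond> (y + y') = x \<diamond> y + x \<diamond> y'"
  using D_add_left[of y y' x] by (simp add: D_commute)

lemma D_scale_right: "x \<in> AA \<Longrightarrow> y \<in> AA \<Longrightarrow> x \<diamond> (c \<star> y) = c \<star> (x \<diamond> y)"
  using D_scale_left[of y x c] by (simp add: D_commute)

lemma D_zero_right [simp]: "x \<in> AA \<Longrightarrow> x \<diamond> 0 = 0"
  using D_scale_right[of x 0 0] by simp

lemma D_zero_left [simp]: "x \<in> AA \<Longrightarrow> 0 \<diamond> x = 0"
  using D_scale_left[of 0 x 0] by simp

lemmas D_linear = D_add_left D_add_right D_scale_left D_scale_right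

text \<open>Here the second factor may itself be a product, as is required for iterated
  products.\<close>

lemma D_S:
  assumes "a \<in> L" "b \<in> L" "x \<in> AA"
  shows "S a b \<diamond> x = dia a b x"
  using assms(3) by (induction rule: A_induct)
    (simp_all add: assms(1,2) D_linear D_S_S dia_zero dia_add dia_scale endo_es endo_S endo_A)

section \<open>Associativity of the trace form\<close>

lemma K_A:
  assumes "T \<in> AA" "x \<in> L" "y \<in> L"
  shows "K (T x) y = K x (T y)"
  using assms(1)
proof (induction rule: A_induct)
  case zero
  then show ?case
    using assms(2,3) K_scale_left[of 0 y 0] K_scale_right[of x 0 0]
    by (simp add: zero_fun_apply)
next
  case (add c a b T')
  then show ?case
    using assms(2,3) endoD(1)[OF endo_A[of T']]
    by (simp add: end_scale_def plus_fun_apply K_linear K_S)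
qed

lemma tr_act:
  assumes x: "x \<in> L" and T: "endo T"
  shows "tr (act x T) = 0"
  using assms
  by (simp add: act_def trace_on_diff trace_on_comp_commute endo_maps endo_ad)

text \<open>This is \<open>hv + 1\<close> if 2 is invertible, and 0 in characteristic 2, where both
  halves are 0.\<close>

definition tr_const :: 'k where
  "tr_const = (of_nat hv / 2 + 1 / 2) + (of_nat hv / 2 + 1 / 2)"

lemma tr_S:
  assumes "a \<in> L" "b \<in> L"
  shows "tr (S a b) = tr_const * K a b"
proof -
  \<comment> \<open>The infinite-dimensional premise of \<open>trace_on_rank_one\<close> holds
    because \<open>K u v\<close> is itself a trace.\<close>
  have rank_one: "tr (\<lambda>z. K u z \<cdot> v) = K u v" if "u \<in> L" "v \<in> L" for u v
    using that by (intro trace_on_rank_one) (simp_all add: K_linear, simp add: killing_def)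
  have "tr (S a b) = tr ((of_nat hv / 2) \<star> ((ad a \<circ> ad b) + (ad b \<circ> ad a))
      + (1 / 2) \<star> ((\<lambda>z. K b z \<cdot> a) + (\<lambda>z. K a z \<cdot> b)))"
    using assms by (intro trace_on_cong) (simp add: S_apply end_scale_def plus_fun_apply)
  also have "\<dots> = (of_nat hv / 2) * (K a b + K b a) + (1 / 2) * (K b a + K a b)"
  proof -
    have "(\<lambda>z. K u z \<cdot> v) \<in> L \<rightarrow> L" if "v \<in> L" for u v
      using that by simp
    moreover have "tr (ad u \<circ> ad v) = K u v" for u v
      by (simp add: killing_def)
    ultimately show ?thesis
      using assms by (simp add: trace_on_add trace_on_end_scale endo_maps endo_ad rank_one)
  qed
  also have "\<dots> = tr_const * K a b"
    using assms by (simp add: tr_const_def K_sym[of b] algebra_simps)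
  finally show ?thesis .
qed

text \<open>The commutator terms are traceless, and the two remaining traces agree because
  \<open>T\<close> is self-adjoint.\<close>

lemma tr_dia:
  assumes "a \<in> L" "b \<in> L" "T \<in> AA"
  shows "tr (dia a b T) = tr_const * K a (T b)"
proof -
  have T: "endo T" using assms by (simp add: endo_A)
  have "tr (dia a b T) = (1 / 2) * (tr (S (T a) b) + tr (S a (T b)))
      + (of_nat hv / 4) * (tr (act a (act b T)) + tr (act b (act a T)))"
    unfolding dia_def using assms endoD(1)[OF T] T
    by (simp add: trace_on_add trace_on_end_scale endo_maps endo_act endo_S)
  also have "\<dots> = (1 / 2) * (tr_const * K a (T b) + tr_const * K a (T b))"
    using assms T endoD(1)[OF T] by (simp add: tr_act endo_act tr_S K_A)
  also have "\<dots> = tr_const * K a (T b)"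
  \<comment> \<open>If 2 = 0, both sides vanish since \<open>tr_const\<close> does.\<close>
  proof (cases "(2 :: 'k) = 0")
    case False
    then have "(1 / 2) * (t + t) = t" for t :: 'k
      by (simp add: field_simps)
    then show ?thesis by blast
  qed (simp add: tr_const_def)
  finally show ?thesis .
qed

text \<open>Associativity on generators, after \<open>tr_dia\<close> has removed the trace. One part
  of \<open>dia\<close> becomes a pairing symmetric in \<open>S a b\<close> and
  \<open>S e f\<close>. In the other part, passing from \<open>S a b\<close> to \<open>S e f\<close>
  reverses the order of the two actions, and \<open>dia\<close> contains both orders.\<close>

lemma dia_swap:
  assumes "a \<in> L" "b \<in> L" "c \<in> L" "d \<in> L" "e \<in> L" "f \<in> L"
  shows "K e (dia c d (S a b) f) = K a (dia c d (S e f) b)"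
proof -
  have eval: "K x (dia c d T y) = (1 / 2) * (K (T c) (S x y d) + K (S x y c) (T d))
      + (of_nat hv / 4) * (K x (act c (act d T) y) + K x (act d (act c T) y))"
    if "x \<in> L" "y \<in> L" "T \<in> AA" for x y T
  proof -
    have T: "T c \<in> L" "T d \<in> L" "endo T"
      using that assms by (simp_all add: endo_A endoD(1))
    show ?thesis
      using assms that T unfolding dia_def
      by (simp add: end_scale_def plus_fun_apply K_linear endoD(1)[OF endo_act] endo_act K_S_swap[of x] K_S)
  qed
  \<comment> \<open>Skewness moves both actions onto \<open>e\<close> and \<open>f\<close>, where
    their signs cancel. Then \<open>K_S_swap\<close> recognises the four terms of the iterated
    action on \<open>S e f\<close>.\<close>
  have act: "K e (act u (act v (S a b)) f) = K a (act v (act u (S e f)) b)" if "u \<in> L" "v \<in> L" for u v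
  proof -
    have 1: "K x (act u T y) = - K (br u x) (T y) - K x (T (br u y))"
      if "x \<in> L" "y \<in> L" "u \<in> L" "endo T" for x y u T
      using that by (simp add: act_def K_linear endoD(1) K_br)
    have "K e (act u (act v (S a b)) f) = K (br v (br u e)) (S a b f) + K (br u e) (S a b (br v f))
        + K (br v e) (S a b (br u f)) + K e (S a b (br v (br u f)))"
      using assms that by (simp add: 1 endo_act endo_S)
    also have "\<dots> = K a (act v (act u (S e f)) b)"
      using assms that by (simp add: act_S act_add endo_S plus_fun_apply K_linear K_S_swap[of a] add_ac)
    finally show ?thesis .
  qed
  show ?thesis
    using assms by (simp add: eval act K_S K_sym add.commute)
qed

theorem tr_D_assoc:
  assumes "x \<in> AA" "y \<in> AA" "z \<in> AA"
  shows "tr ((x \<diamond> y) \<diamond> z) = tr (x \<diamond> (y \<diamond> z))"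
proof -
  have left: "tr ((S a b \<diamond> S c d) \<diamond> S e f) = tr (S a b \<diamond> (S c d \<diamond> S e f))"
    if "a \<in> L" "b \<in> L" "c \<in> L" "d \<in> L" "e \<in> L" "f \<in> L" for a b c d e f
  proof -
    \<comment> \<open>Commutativity puts the outer generator in front, so that both traces have the
      form covered by \<open>tr_dia\<close>.\<close>
    have "(S a b \<diamond> S c d) \<diamond> S e f = S e f \<diamond> (S c d \<diamond> S a b)"
      using that by (simp add: D_commute)
    then show ?thesis
      using that by (simp add: D_S tr_dia dia_A dia_swap)
  qed
  have tr_lin: "tr (c \<star> u + v) = c * tr u + tr v" if "u \<in> AA" "v \<in> AA" for c u v
    using that by (simp add: trace_on_add trace_on_end_scale endo_maps endo_A)
  have 1: "tr ((S a b \<diamond> S c d) \<diamond> z) = tr (S a b \<diamond> (S c d \<diamond> z))"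
    if "a \<in> L" "b \<in> L" "c \<in> L" "d \<in> L" for a b c d
    using assms(3) by (induction rule: A_induct) (simp_all add: that D_linear tr_lin left)
  have 2: "tr ((S a b \<diamond> y) \<diamond> z) = tr (S a b \<diamond> (y \<diamond> z))"
    if "a \<in> L" "b \<in> L" for a b
    using assms(2) by (induction rule: A_induct) (simp_all add: that assms(3) D_linear tr_lin 1)
  show ?thesis
    using assms(1) by (induction rule: A_induct) (simp_all add: assms(2,3) D_linear tr_lin 2)
qed

end

section \<open>Left invariant derivations form a Lie algebra\<close>

lemma lookup_formal_scale [simp]:
  "Poly_Mapping.lookup (formal_scale c t) w = c * Poly_Mapping.lookup t w"
  by (simp add: formal_scale_def Poly_Mapping.map.rep_eq when_def)

interpretation formal: Modules.module
  "formal_scale :: 'b::comm_ring_1 \<Rightarrow> ('w \<Rightarrow>\<^sub>0 'b) \<Rightarrow> ('w \<Rightarrow>\<^sub>0 'b)"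
  by unfold_locales (auto intro!: poly_mapping_eqI simp: lookup_add algebra_simps)

text \<open>Keys may cancel in sums; a common finite index set makes the expansions
  comparable.\<close>

lemma formal_extend_eq:
  assumes "finite K" "Poly_Mapping.keys t \<subseteq> K"
  shows "formal_extend f t = (\<Sum>w\<in>K. formal_scale (Poly_Mapping.lookup t w) (f w))"
  unfolding formal_extend_def
  by (rule sum.mono_neutral_left) (use assms in \<open>auto simp: in_keys_iff\<close>)

lemma formal_extend_add: "formal_extend f (s + t) = formal_extend f s + formal_extend f t"
  using Poly_Mapping.keys_add[of s t]
  by (simp add: formal_extend_eq[of "Poly_Mapping.keys s \<union> Poly_Mapping.keys t"] lookup_add
      formal.scale_left_distrib sum.distrib)

lemma formal_extend_scale: "formal_extend f (formal_scale c t) = formal_scale c (formal_extend f t)"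
proof -
  have "Poly_Mapping.keys (formal_scale c t) \<subseteq> Poly_Mapping.keys t"
    by (auto simp: in_keys_iff)
  then show ?thesis
    by (simp add: formal_extend_eq[of "Poly_Mapping.keys t"] formal.scale_sum_right)
qed

lemma formal_extend_zero [simp]: "formal_extend f 0 = 0"
  by (simp add: formal_extend_def)

lemma formal_extend_diff: "formal_extend f (s - t) = formal_extend f s - formal_extend f t"
  using formal_extend_add[of f "s - t" t] by simp

lemma formal_extend_sum: "formal_extend f (sum g I) = (\<Sum>i\<in>I. formal_extend f (g i))"
  by (induction I rule: infinite_finite_induct) (simp_all add: formal_extend_add)

lemma formal_extend_single [simp]:
  "formal_extend f (Poly_Mapping.single w c) = formal_scale c (f w)"
  by (simp add: formal_extend_eq[of "{w}"])

lemma formal_extend_formal_extend: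
  "formal_extend f (formal_extend g t) = formal_extend (\<lambda>w. formal_extend f (g w)) t"
  unfolding formal_extend_def[of g] formal_extend_def[of "\<lambda>w. formal_extend f (g w)"]
  by (simp add: formal_extend_sum formal_extend_scale)

lemma formal_extend_cong:
  "(\<And>w. w \<in> Poly_Mapping.keys t \<Longrightarrow> f w = g w) \<Longrightarrow> formal_extend f t = formal_extend g t"
  by (simp add: formal_extend_def)

section \<open>Null tensors and well-definedness of id \<otimes> D\<close>

lemma relator_add_null:
  "Poly_Mapping.single (xs @ [a + b] @ ys) 1 - Poly_Mapping.single (xs @ [a] @ ys) 1
     - Poly_Mapping.single (xs @ [b] @ ys) 1 \<in> tensor_null u v"
  unfolding tensor_null_def
  by (rule formal.span_base) (unfold tensor_relators_def, blast)

lemma relator_scale_null: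
  "Poly_Mapping.single (xs @ [u c * a] @ ys) 1 - Poly_Mapping.single (xs @ [a] @ ys) (v c)
     \<in> tensor_null u v"
  unfolding tensor_null_def
  by (rule formal.span_base) (unfold tensor_relators_def, blast)

lemma subspace_tensor_null: "formal.subspace (tensor_null u v)"
  by (simp add: tensor_null_def)

lemma formal_extend_null:
  assumes "s \<in> tensor_null u v" "\<And>r. r \<in> tensor_relators u v \<Longrightarrow> formal_extend f r \<in> tensor_null u v"
  shows "formal_extend f s \<in> tensor_null u v"
  using assms(1) unfolding tensor_null_def[of u v]
proof (induction rule: formal.span_induct_alt)
  case (step c x y)
  then show ?case
    using assms(2) subspace_tensor_null[of u v] unfolding tensor_null_def[symmetric]
    by (simp add: formal_extend_add formal_extend_scale formal.subspace_add formal.subspace_scale)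
qed (simp add: formal.span_zero)

text \<open>On words of length 2 this is id \<otimes> D, so that left invariance of \<open>D\<close>
  says that comultiplication after \<open>D\<close> is id \<otimes> D after
  comultiplication.\<close>

definition apply_right :: "('a \<Rightarrow> 'a) \<Rightarrow> 'a list \<Rightarrow> ('a list \<Rightarrow>\<^sub>0 'b::comm_ring_1)" where
  "apply_right D w = Poly_Mapping.single [w ! 0, D (w ! 1)] 1"

text \<open>Since \<open>D\<close> is linear, id \<otimes> D sends relators to relators: those in
  the first letter keep their form, those in the second are transformed by \<open>D\<close>. This
  allows left invariance to be used twice in \<open>co_mult_comp\<close>.\<close>

lemma apply_right_null:
  fixes u :: "'k \<Rightarrow> 'a::comm_ring_1" and v :: "'k \<Rightarrow> 'b::comm_ring_1"
  assumes s: "s \<in> tensor_null u v" "\<And>w. w \<in> Poly_Mapping.keys s \<Longrightarrow> length w = 2"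
    and D: "\<And>a b. D (a + b) = D a + D b" "\<And>c a. D (u c * a) = u c * D a"
  shows "formal_extend (apply_right D) s \<in> tensor_null u v"
proof -
  \<comment> \<open>The relators of other lengths have to be discarded: on them \<open>apply_right\<close> is junk.\<close>
  define f :: "'a list \<Rightarrow> ('a list \<Rightarrow>\<^sub>0 'b)" where
    "f w = (if length w = 2 then apply_right D w else 0)" for w
  \<comment> \<open>The words of a relator have length \<open>length xs + length ys + 1\<close>, so
    in length 2 the varying letter is the first or the second.\<close>
  have split: "(xs = [] \<and> (\<exists>y. ys = [y])) \<or> ((\<exists>x. xs = [x]) \<and> ys = [])"
    if "length xs + length ys = 1" for xs ys :: "'a list"
    using that by (cases xs; cases ys) auto
  have null0: "0 \<in> tensor_null u v"
    by (simp add: subspace_tensor_null formal.subspace_0)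
  have "formal_extend f r \<in> tensor_null u v" if r: "r \<in> tensor_relators u v" for r
  proof -
    consider (add) xs a b ys where "r = Poly_Mapping.single (xs @ [a + b] @ ys) 1
          - Poly_Mapping.single (xs @ [a] @ ys) 1 - Poly_Mapping.single (xs @ [b] @ ys) 1"
      | (scale) xs c a ys where
        "r = Poly_Mapping.single (xs @ [u c * a] @ ys) 1 - Poly_Mapping.single (xs @ [a] @ ys) (v c)"
      using r unfolding tensor_relators_def by blast
    then show ?thesis
    proof cases
      case add
      show ?thesis
      proof (cases "length xs + length ys = 1")
        case True
        then consider y where "xs = []" "ys = [y]" | x where "xs = [x]" "ys = []"
          using split by blast
        then show ?thesis
        proof cases
          case 1
          with add show ?thesis
            using relator_add_null[of "[]" a b "[D y]" u v]
            by (simp add: formal_extend_diff f_def apply_right_def)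
        next
          case 2
          with add show ?thesis
            using relator_add_null[of "[x]" "D a" "D b" "[]" u v]
            by (simp add: formal_extend_diff f_def apply_right_def D)
        qed
      qed (use add null0 in \<open>simp add: formal_extend_diff f_def\<close>)
    next
      case scale
      have formal_single: "formal_scale e (Poly_Mapping.single w 1) = Poly_Mapping.single w e"
        for e :: 'b and w :: "'a list"
        by (rule poly_mapping_eqI) (simp add: lookup_single when_def)
      show ?thesis
      proof (cases "length xs + length ys = 1")
        case True
        then consider y where "xs = []" "ys = [y]" | x where "xs = [x]" "ys = []"
          using split by blast
        then show ?thesis
        proof cases
          case 1
          with scale show ?thesis
            using relator_scale_null[of "[]" u c a "[D y]" v]
            by (simp add: formal_extend_diff f_def apply_right_def formal_single)
        next
          case 2
          with scale show ?thesis
            using relator_scale_null[of "[x]" u c "D a" "[]" v]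
            by (simp add: formal_extend_diff f_def apply_right_def D formal_single)
        qed
      qed (use scale null0 in \<open>simp add: formal_extend_diff f_def\<close>)
    qed
  qed
  then have "formal_extend f s \<in> tensor_null u v"
    by (rule formal_extend_null[OF s(1)])
  moreover have "formal_extend f s = formal_extend (apply_right D) s"
    by (rule formal_extend_cong) (simp add: f_def s(2))
  ultimately show ?thesis by simp
qed

section \<open>Equality of tensors as a congruence\<close>

lemma tensor_eq_refl: "tensor_eq G s s"
  by (simp add: tensor_eq_def subspace_tensor_null formal.subspace_0)

lemma tensor_eq_sym: "tensor_eq G s t \<Longrightarrow> tensor_eq G t s"
  using formal.subspace_neg[OF subspace_tensor_null, of "s - t"] by (simp add: tensor_eq_def)

lemma tensor_eq_trans [trans]: "tensor_eq G s t \<Longrightarrow> tensor_eq G t r \<Longrightarrow> tensor_eq G s r"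
  using formal.subspace_add[OF subspace_tensor_null, of "s - t" _ _ "t - r"]
  by (simp add: tensor_eq_def)

lemma tensor_eq_add:
  "tensor_eq G s t \<Longrightarrow> tensor_eq G s' t' \<Longrightarrow> tensor_eq G (s + s') (t + t')"
  using formal.subspace_add[OF subspace_tensor_null, of "s - t" _ _ "s' - t'"]
  by (simp add: tensor_eq_def algebra_simps)

lemma tensor_eq_diff:
  "tensor_eq G s t \<Longrightarrow> tensor_eq G s' t' \<Longrightarrow> tensor_eq G (s - s') (t - t')"
  using formal.subspace_diff[OF subspace_tensor_null, of "s - t" _ _ "s' - t'"]
  by (simp add: tensor_eq_def algebra_simps)

lemma tensor_eq_scale: "tensor_eq G s t \<Longrightarrow> tensor_eq G (formal_scale c s) (formal_scale c t)"
  using formal.subspace_scale[OF subspace_tensor_null, of "s - t" _ _ c]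
  by (simp add: tensor_eq_def formal.scale_right_diff_distrib)

lemma tensor_eq_formal_extend:
  assumes "\<And>w. tensor_eq G (f w) (g w)"
  shows "tensor_eq G (formal_extend f t) (formal_extend g t)"
proof -
  have "formal_extend f t - formal_extend g t =
      (\<Sum>w\<in>Poly_Mapping.keys t. formal_scale (Poly_Mapping.lookup t w) (f w - g w))"
    by (simp add: formal_extend_def sum_subtractf formal.scale_right_diff_distrib)
  then show ?thesis
    using assms unfolding tensor_eq_def
    by (auto intro!: formal.subspace_sum formal.subspace_scale subspace_tensor_null)
qed

lemma formal_extend_add_fun:
  "formal_extend (\<lambda>w. f w + g w) t = formal_extend f t + formal_extend g t"
  by (simp add: formal_extend_def sum.distrib formal.scale_right_distrib)

lemma formal_extend_scale_fun:
  "formal_extend (\<lambda>w. formal_scale c (f w)) t = formal_scale c (formal_extend f t)"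
  by (simp add: formal_extend_def formal.scale_sum_right mult.commute)

section \<open>Closure properties of left invariant derivations\<close>

lemma Lie_iff:
  "D \<in> Lie G \<longleftrightarrow>
     (\<forall>a b. D (a + b) = D a + D b) \<and>
     (\<forall>c a. D (str_map G c * a) = str_map G c * D a) \<and>
     (\<forall>a b. D (a * b) = a * D b + D a * b) \<and>
     (\<forall>a. tensor_eq G (co_mult G (D a)) (formal_extend (apply_right D) (co_mult G a)))"
  by (simp add: Lie_def apply_right_def[abs_def])

lemma LieD:
  assumes "D \<in> Lie G"
  shows "D (a + b) = D a + D b"
    and "D (str_map G c * a) = str_map G c * D a"
    and "D (a * b) = a * D b + D a * b"
    and "tensor_eq G (co_mult G (D a)) (formal_extend (apply_right D) (co_mult G a))"
  using assms unfolding Lie_iff by blast+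

lemma Lie_diff: "D \<in> Lie G \<Longrightarrow> D (a - b) = D a - D b"
  using LieD(1)[of D G "a - b" b] by simp

context
  fixes G :: "('k::field, 'a::comm_ring_1) group_scheme"
  assumes G: "affine_group_scheme G"
begin

lemma str_map_hom:
  shows str_map_one: "str_map G 1 = 1"
    and str_map_add: "str_map G (c + d) = str_map G c + str_map G d"
    and str_map_mult: "str_map G (c * d) = str_map G c * str_map G d"
  using G by (simp_all add: affine_group_scheme_def alg_hom_def)

lemma co_mult_length: "w \<in> Poly_Mapping.keys (co_mult G a) \<Longrightarrow> length w = 2"
  using G by (simp add: affine_group_scheme_def)

lemma co_mult_add: "tensor_eq G (co_mult G (a + b)) (co_mult G a + co_mult G b)"
  using G by (simp add: affine_group_scheme_def)

lemma co_mult_scale: "tensor_eq G (co_mult G (str_map G c * a)) (formal_scale c (co_mult G a))"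
  using G by (simp add: affine_group_scheme_def)

lemma apply_right_add:
  "tensor_eq G (apply_right (D + E) w) (apply_right D w + apply_right E w)"
  using relator_add_null[of "[w ! 0]" "D (w ! 1)" "E (w ! 1)" "[]" "str_map G" "id :: 'k \<Rightarrow> 'k"]
  by (simp add: tensor_eq_def apply_right_def diff_diff_eq)

lemma apply_right_lie_scale:
  "tensor_eq G (apply_right (lie_scale G c D) w) (formal_scale c (apply_right D w))"
proof -
  have "formal_scale c (apply_right D w) = Poly_Mapping.single [w ! 0, D (w ! 1)] c"
    unfolding apply_right_def by (rule poly_mapping_eqI) (simp add: lookup_single when_def)
  then show ?thesis
    using relator_scale_null[of "[w ! 0]" "str_map G" c "D (w ! 1)" "[]" "id :: 'k \<Rightarrow> 'k"]
    by (simp add: tensor_eq_def apply_right_def lie_scale_def)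
qed

lemma vector_space_lie_scale: "vector_space (lie_scale G)"
  by unfold_locales
    (auto simp: lie_scale_def str_map_hom algebra_simps)

lemma Lie_add:
  assumes "D \<in> Lie G" "E \<in> Lie G"
  shows "D + E \<in> Lie G"
proof -
  have "tensor_eq G (co_mult G ((D + E) a)) (formal_extend (apply_right (D + E)) (co_mult G a))" for a
  proof -
    have "tensor_eq G (co_mult G (D a + E a)) (co_mult G (D a) + co_mult G (E a))"
      by (rule co_mult_add)
    also have "tensor_eq G \<dots> (formal_extend (apply_right D) (co_mult G a)
        + formal_extend (apply_right E) (co_mult G a))"
      using assms by (intro tensor_eq_add) (simp_all add: Lie_iff)
    also have "tensor_eq G \<dots> (formal_extend (apply_right (D + E)) (co_mult G a))"
      unfolding formal_extend_add_fun[symmetric]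
      by (intro tensor_eq_sym[OF tensor_eq_formal_extend] apply_right_add)
    finally show ?thesis by simp
  qed
  with assms show ?thesis
    unfolding Lie_iff[of "D + E"]
    by (auto simp: LieD(1,2) distrib_left) (simp add: LieD(3) algebra_simps)
qed

lemma Lie_scale:
  assumes "D \<in> Lie G"
  shows "lie_scale G c D \<in> Lie G"
proof -
  have "tensor_eq G (co_mult G (lie_scale G c D a))
      (formal_extend (apply_right (lie_scale G c D)) (co_mult G a))" for a
  proof -
    have "tensor_eq G (co_mult G (str_map G c * D a)) (formal_scale c (co_mult G (D a)))"
      by (rule co_mult_scale)
    also have "tensor_eq G \<dots> (formal_scale c (formal_extend (apply_right D) (co_mult G a)))"
      using assms by (intro tensor_eq_scale) (simp add: Lie_iff)
    also have "tensor_eq G \<dots> (formal_extend (apply_right (lie_scale G c D)) (co_mult G a))"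
      unfolding formal_extend_scale_fun[symmetric]
      by (intro tensor_eq_sym[OF tensor_eq_formal_extend] apply_right_lie_scale)
    finally show ?thesis by (simp add: lie_scale_def)
  qed
  with assms show ?thesis
    unfolding Lie_iff[of "lie_scale G c D"]
    by (auto simp: lie_scale_def LieD(1,2) distrib_left mult.left_commute)
      (simp add: LieD(3) algebra_simps)
qed

lemma str_map_zero: "str_map G 0 = 0"
  using str_map_add[of 0 0] by simp

lemma Lie_zero: "0 \<in> Lie G"
proof -
  \<comment> \<open>A word with second letter 0 is not the formal sum 0. It is null by the scaling
    relator for the scalar 0.\<close>
  have null: "tensor_eq G (apply_right 0 w) 0" for w
    using apply_right_lie_scale[of 0 0 w] by (simp add: lie_scale_def str_map_zero zero_fun_def)
  have "tensor_eq G (co_mult G 0) 0"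
    using co_mult_scale[of 0 0] by (simp add: str_map_zero)
  moreover have "tensor_eq G (formal_extend (apply_right 0) t) 0" for t
    using tensor_eq_formal_extend[of G "apply_right 0" "\<lambda>_. 0" t] null
    by (simp add: formal_extend_def)
  ultimately show ?thesis
    by (auto simp: Lie_iff intro: tensor_eq_trans tensor_eq_sym)
qed

text \<open>Invariance of \<open>D\<close>, then of \<open>E\<close>. Inserting the second equation
  under id \<otimes> D is legitimate by \<open>apply_right_null\<close>, for which all words must
  have length 2.\<close>

lemma co_mult_comp:
  assumes "D \<in> Lie G" "E \<in> Lie G"
  shows "tensor_eq G (co_mult G (D (E a))) (formal_extend (apply_right (D \<circ> E)) (co_mult G a))"
proof -
  let ?t = "formal_extend (apply_right E) (co_mult G a)"
  have "length w = 2" if "w \<in> Poly_Mapping.keys ?t" for w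
  proof (rule ccontr)
    assume "length w \<noteq> 2"
    then have "Poly_Mapping.lookup ?t w = 0"
      by (auto simp: formal_extend_def lookup_sum apply_right_def lookup_single when_def
          intro!: sum.neutral)
    with that show False by (simp add: in_keys_iff)
  qed
  then have "length w = 2" if "w \<in> Poly_Mapping.keys (co_mult G (E a) - ?t)" for w
    using that co_mult_length[of w "E a"] by (fastforce simp: in_keys_iff lookup_minus)
  then have "formal_extend (apply_right D) (co_mult G (E a) - ?t) \<in> tensor_null (str_map G) id"
    using LieD(4)[OF assms(2), of a]
    by (intro apply_right_null LieD(1,2)[OF assms(1)]) (simp_all add: tensor_eq_def)
  moreover have "formal_extend (apply_right D) ?t = formal_extend (apply_right (D \<circ> E)) (co_mult G a)"
    unfolding formal_extend_formal_extend by (rule formal_extend_cong) (simp add: apply_right_def)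
  ultimately have "tensor_eq G (formal_extend (apply_right D) (co_mult G (E a)))
      (formal_extend (apply_right (D \<circ> E)) (co_mult G a))"
    by (simp add: tensor_eq_def formal_extend_diff)
  moreover have "tensor_eq G (co_mult G (D (E a))) (formal_extend (apply_right D) (co_mult G (E a)))"
    using assms by (simp add: Lie_iff)
  ultimately show ?thesis
    by (rule tensor_eq_trans[rotated])
qed

text \<open>Invariance follows from that of the two composites. In the product rule the mixed terms
  of the composites cancel.\<close>

lemma Lie_bracket:
  assumes "D \<in> Lie G" "E \<in> Lie G"
  shows "lie_bracket D E \<in> Lie G"
proof -
  let ?B = "lie_bracket D E"
  have "tensor_eq G (co_mult G (?B a)) (formal_extend (apply_right ?B) (co_mult G a))" for a
  proof -
    let ?t = "co_mult G a"
    \<comment> \<open>Written as a sum, since \<open>apply_right_add\<close> treats sums;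
      subtraction of the composite follows afterwards.\<close>
    have B: "?B + (E \<circ> D) = D \<circ> E"
      by (rule ext) (simp add: lie_bracket_def)
    have "tensor_eq G (co_mult G (?B a + E (D a))) (co_mult G (?B a) + co_mult G (E (D a)))"
      by (rule co_mult_add)
    then have "tensor_eq G (co_mult G (D (E a))) (co_mult G (?B a) + co_mult G (E (D a)))"
      by (simp add: lie_bracket_def)
    from tensor_eq_diff[OF tensor_eq_sym[OF this] tensor_eq_refl[of G "co_mult G (E (D a))"]]
    have "tensor_eq G (co_mult G (?B a)) (co_mult G (D (E a)) - co_mult G (E (D a)))"
      by simp
    also have "tensor_eq G \<dots>
        (formal_extend (apply_right (D \<circ> E)) ?t - formal_extend (apply_right (E \<circ> D)) ?t)"
      using assms by (intro tensor_eq_diff co_mult_comp)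
    also have "tensor_eq G \<dots> (formal_extend (apply_right ?B) ?t)"
    proof -
      have "tensor_eq G (formal_extend (apply_right (D \<circ> E)) ?t)
          (formal_extend (apply_right ?B) ?t + formal_extend (apply_right (E \<circ> D)) ?t)"
        unfolding formal_extend_add_fun[symmetric] B[symmetric]
        by (intro tensor_eq_formal_extend apply_right_add)
      from tensor_eq_diff[OF this tensor_eq_refl[of G "formal_extend (apply_right (E \<circ> D)) ?t"]]
      show ?thesis by simp
    qed
    finally show ?thesis .
  qed
  with assms show ?thesis
    unfolding Lie_iff[of ?B]
    by (auto simp: lie_bracket_def LieD(1,2) right_diff_distrib)
      (simp add: LieD(1,3) algebra_simps)
qed

lemma lie_algebra_on_Lie: "lie_algebra_on (lie_scale G) (Lie G) lie_bracket"
proof -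
  interpret vector_space "lie_scale G"
    by (rule vector_space_lie_scale)
  show ?thesis
  proof
    show "subspace (Lie G)"
      by (auto simp: subspace_def Lie_zero Lie_add Lie_scale)
    show "lie_bracket D E \<in> Lie G" if "D \<in> Lie G" "E \<in> Lie G" for D E
      using that by (rule Lie_bracket)
  qed (auto simp: lie_bracket_def lie_scale_def LieD(1,2) Lie_diff fun_eq_iff right_diff_distrib)
qed

end

section \<open>Transfer to the algebraic group\<close>

theorem lemma6p1:
  fixes G :: "('k::field, 'a::comm_ring_1) group_scheme"
    and \<Phi> :: "'e::euclidean_space set"
    and a a' a'' :: "('a \<Rightarrow> 'a) \<Rightarrow> ('a \<Rightarrow> 'a)"
  assumes "absolutely_simple_group G \<Phi>"
    and "CHAR('k) = 0 \<or> CHAR('k) \<ge> coxeter_number \<Phi> + 2"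
    and "a \<in> group_alg G \<Phi>" and "a' \<in> group_alg G \<Phi>" and "a'' \<in> group_alg G \<Phi>"
  shows "group_tau G \<Phi> (group_diamond G \<Phi> a a') a'' = group_tau G \<Phi> a (group_diamond G \<Phi> a' a'')"
proof -
  interpret lie_algebra_on "lie_scale G" "Lie G" lie_bracket "dual_coxeter_number \<Phi>"
    using assms(1) by (intro lie_algebra_on_Lie) (simp add: absolutely_simple_group_def)
  \<comment> \<open>Both sides carry the same factor \<open>1 / of_nat (scheme_dim G)\<close>, so
    the equality of traces suffices.\<close>
  show ?thesis
    using assms(3-5) by (simp add: group_tau_def group_diamond_def group_alg_def tr_D_assoc)
qed

end
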